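(* Let $1\le m\le n$, let $A\in\mathbb{R}^{n\times n}$ be symmetric positive definite, let $V\in\mathbb{R}^{n\times m}$ be full-rank, put $W=V$, and let $b,x_0\in\mathbb{R}^n$. Let $Y\in\mathbb{R}^{n\times(n-m)}$ satisfy $\mathrm{Range}(Y)=\mathrm{Null}(W^{T}A)$ and $Y^{T}AY=I$. Let $P_1=I-V(W^{T}AV)^{-1}W^{T}A$. Let $\alpha,\beta>0$, let $s>0$ be a random variable with prior distribution $\mathsf{IG}(\alpha,\beta)$, and suppose that, given $s$, $x\sim\mathcal{N}(x_0,VV^{T}+sYY^{T})$. Let $Z_{\star 1},\dots,Z_{\star k}$ be i.i.d. (given $s$) observations of the random variable $A^{1/2}P_1(x-x_0)$, independent of $x$ given $s$, collected as columns of $Z\in\mathbb{R}^{n\times k}$. Put $$\widetilde{\alpha}=\alpha+\frac{k(n-m)}{2},\qquad \widetilde{\beta}=\beta+\frac{\mathrm{tr}(Z^{T}Z)}{2},\qquad \widetilde{x}=x_0+V(W^{T}AV)^{-1}W^{T}(b-Ax_0).$$ Then: 1. The posterior distribution of $s$ given $Z$ is $\mathsf{IG}(\widetilde{\alpha},\widetilde{\beta})$. 2. The predictive distribution of $x$ given $W^{T}Ax=W^{T}b$ and $Z$ is the multivariate Student distribution $\mathsf{St}_{2\widetilde{\alpha}}\left(\widetilde{x},\frac{\widetilde{\beta}}{\widetilde{\alpha}}YY^{T}\right)$.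
   Context: $\mathsf{IG}(\alpha,\beta)$ is the inverse-gamma distribution with density $\frac{\beta^{\alpha}}{\Gamma(\alpha)}s^{-(\alpha+1)}e^{-\beta/s}$ on $s>0$. $A^{1/2}$ is the symmetric positive definite square root. For symmetric positive semidefinite $\Sigma\in\mathbb{R}^{n\times n}$ of rank $r$ with spectral decomposition $\Sigma=UDU^{T}$ ($U\in\mathbb{R}^{n\times r}$, $U^TU=I$, $D>0$ diagonal) and $\mu\in\mathbb{R}^n$: $\mathcal{N}(\mu,\Sigma)$ is the (possibly degenerate) Gaussian distribution with mean $\mu$ and covariance $\Sigma$; and $\mathsf{St}_\nu(\mu,\Sigma)$ is the distribution supported on the affine subspace $\mu+\mathrm{Range}(\Sigma)$ with density, with respect to $r$-dimensional Lebesgue measure on that subspace, $$\frac{\Gamma\left(\frac{\nu+r}{2}\right)}{\Gamma\left(\frac{\nu}{2}\right)\sqrt{(\pi\nu)^r\det D}}\left(1+\frac1\nu(x-\mu)^T\Sigma^{\dagger}(x-\mu)\right)^{-\frac{\nu+r}{2}},$$ where $\Sigma^\dagger$ is the Moore–Penrose pseudoinverse. *)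

theory Defs
  imports "HOL-Probability.Probability"
begin

text \<open>
  Matrices with a possibly vanishing number \<open>p\<close> of columns are given by their columns
  \<open>Y 0, \<dots>, Y (p - 1)\<close>, as there is no empty index type.  For such a matrix \<open>Y\<close>,
  the matrix \<open>Y diag(d) Y\<^sup>T\<close> is the following one.
\<close>

definition cols_diag_cols ::
  "nat \<Rightarrow> (nat \<Rightarrow> real ^ 'n) \<Rightarrow> (nat \<Rightarrow> real) \<Rightarrow> real ^ 'n ^ 'n" where
  "cols_diag_cols p Y d = (\<chi> i j. \<Sum>l<p. d l * Y l $ i * Y l $ j)"

definition orthonormal_cols :: "nat \<Rightarrow> (nat \<Rightarrow> real ^ 'n) \<Rightarrow> bool" where
  "orthonormal_cols p U \<longleftrightarrow> (\<forall>i<p. \<forall>j<p. U i \<bullet> U j = (if i = j then 1 else 0))"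

definition spectral_decomposition ::
  "real ^ 'n ^ 'n \<Rightarrow> (nat \<Rightarrow> real ^ 'n) \<Rightarrow> (nat \<Rightarrow> real) \<Rightarrow> bool" where
  "spectral_decomposition \<Sigma> U d \<longleftrightarrow>
     orthonormal_cols (rank \<Sigma>) U \<and> (\<forall>i<rank \<Sigma>. 0 < d i) \<and> \<Sigma> = cols_diag_cols (rank \<Sigma>) U d"

definition sym_pos_def :: "real ^ 'n ^ 'n \<Rightarrow> bool" where
  "sym_pos_def A \<longleftrightarrow> transpose A = A \<and> (\<forall>v. v \<noteq> 0 \<longrightarrow> 0 < v \<bullet> (A *v v))"

definition matrix_sqrt :: "real ^ 'n ^ 'n \<Rightarrow> real ^ 'n ^ 'n" where
  "matrix_sqrt A = (THE B. sym_pos_def B \<and> B ** B = A)"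

text \<open>The Moore--Penrose pseudoinverse, by the four Penrose equations.\<close>

definition pinv :: "real ^ 'n ^ 'm \<Rightarrow> real ^ 'm ^ 'n" where
  "pinv A = (THE X. A ** X ** A = A \<and> X ** A ** X = X \<and>
     transpose (A ** X) = A ** X \<and> transpose (X ** A) = X ** A)"

definition inverse_gamma :: "real \<Rightarrow> real \<Rightarrow> real measure" where
  "inverse_gamma \<alpha> \<beta> = density lborel (\<lambda>s. ennreal
     (if 0 < s then \<beta> powr \<alpha> / Gamma \<alpha> * s powr (- (\<alpha> + 1)) * exp (- \<beta> / s) else 0))"

definition std_gaussian :: "(real ^ 'n) measure" where
  "std_gaussian = density lborel (\<lambda>z. ennreal (\<Prod>i\<in>UNIV. std_normal_density (z $ i)))"

text \<open>
  The law of \<open>\<mu> + L \<xi>\<close> with \<open>\<xi>\<close> standard Gaussian and \<open>L L\<^sup>T = \<Sigma>\<close>.  Such an \<open>L\<close>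
  exists iff \<open>\<Sigma>\<close> is symmetric positive semidefinite, and the law does not depend on
  its choice.
\<close>

definition gaussian :: "real ^ 'n \<Rightarrow> real ^ 'n ^ 'n \<Rightarrow> (real ^ 'n) measure" where
  "gaussian \<mu> \<Sigma> =
     (let L = (SOME L :: real ^ 'n ^ 'n. L ** transpose L = \<Sigma>)
      in distr std_gaussian borel (\<lambda>z. \<mu> + L *v z))"

text \<open>
  The \<open>r\<close>-dimensional Lebesgue measure on \<open>\<mu> + S\<close>, for a subspace \<open>S\<close> of dimension
  \<open>r\<close>, as a measure on the ambient space.  It is transported from coordinates with respect
  to an orthonormal basis of \<open>S\<close>, the choice of which is immaterial.  For \<open>r = 0\<close> it is
  the point mass at \<open>\<mu>\<close>.
\<close>

definition affine_lebesgue :: "real ^ 'n \<Rightarrow> (real ^ 'n) set \<Rightarrow> (real ^ 'n) measure" where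
  "affine_lebesgue \<mu> S =
     (let r = dim S;
          U = (SOME U. orthonormal_cols r U \<and> span (U ` {..<r}) = S)
      in distr (Pi\<^sub>M {..<r} (\<lambda>_. lborel)) borel (\<lambda>y. \<mu> + (\<Sum>i<r. y i *\<^sub>R U i)))"

definition student :: "real \<Rightarrow> real ^ 'n \<Rightarrow> real ^ 'n ^ 'n \<Rightarrow> (real ^ 'n) measure" where
  "student \<nu> \<mu> \<Sigma> =
     (let r = rank \<Sigma>;
          d = (SOME d. \<exists>U. spectral_decomposition \<Sigma> U d)
      in density (affine_lebesgue \<mu> (range ((*v) \<Sigma>))) (\<lambda>x. ennreal
           (Gamma ((\<nu> + real r) / 2) / (Gamma (\<nu> / 2) * sqrt ((pi * \<nu>) ^ r * (\<Prod>i<r. d i)))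
            * (1 + 1 / \<nu> * ((x - \<mu>) \<bullet> (pinv \<Sigma> *v (x - \<mu>)))) powr (- (\<nu> + real r) / 2))))"

text \<open>
  The probability kernel \<open>\<kappa>\<close> is a regular conditional distribution of \<open>X\<close> given \<open>T\<close>.
  As usual, \<open>\<kappa>\<close> is determined by this only up to a null set of the law of \<open>T\<close>.
\<close>

definition has_cond_law ::
  "'w measure \<Rightarrow> 'a measure \<Rightarrow> ('w \<Rightarrow> 'a) \<Rightarrow> 'b measure \<Rightarrow> ('w \<Rightarrow> 'b) \<Rightarrow> ('b \<Rightarrow> 'a measure) \<Rightarrow> bool"
  where
  "has_cond_law M N X L T \<kappa> \<longleftrightarrow>
     X \<in> M \<rightarrow>\<^sub>M N \<and> T \<in> M \<rightarrow>\<^sub>M L \<and> \<kappa> \<in> L \<rightarrow>\<^sub>M prob_algebra N \<and>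
     (\<forall>B\<in>sets N. \<forall>C\<in>sets L.
        emeasure M {\<omega> \<in> space M. X \<omega> \<in> B \<and> T \<omega> \<in> C} = (\<integral>\<^sup>+t\<in>C. emeasure (\<kappa> t) B \<partial>distr M L T))"

end

theory Submission
  imports Defs
begin

text \<open>
  Since \<open>V\<^sup>T A Y = 0\<close>, the columns of \<open>V\<close> and \<open>Y\<close> together form a basis of the whole space, in
  which \<open>x = x\<^sub>0 + V u + Y y\<close> with \<open>u\<close> standard normal and \<open>y\<close> normal with covariance \<open>s I\<close>.
  Given \<open>s\<close>, the two parts are independent; \<open>V\<^sup>T A x\<close> determines \<open>u\<close> and is independent of \<open>y\<close>
  and \<open>s\<close>, while the observations are \<open>A\<^sup>1\<^sup>/\<^sup>2 Y w\<close> for independent copies \<open>w\<close> of \<open>y\<close>, with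
  \<open>A\<^sup>1\<^sup>/\<^sup>2 Y\<close> orthonormal. So \<open>tr(Z\<^sup>T Z)\<close> is the sum of the squares of \<open>k p\<close> centred
  normal numbers of variance \<open>s\<close>, inverse gamma conjugacy gives the posterior, and integrating \<open>s\<close> out of
  \<open>y\<close> against it gives the Student law. No determinant is needed: two families \<open>B\<close>, \<open>C\<close> with
  \<open>B B\<^sup>T = C C\<^sup>T\<close> differ by an orthogonal change of coordinates, under which Lebesgue measure is invariant.
\<close>

section \<open>Lebesgue measure in orthonormal coordinates\<close>

text \<open>The law of \<open>Z\<close> has no density on the space of matrices: its columns stay in
  the span of the vectors \<open>matrix_sqrt A *v Y l\<close>, a proper subspace. Bayes' rule for
  Lebesgue densities is therefore replaced by nonnegative integrals over the coordinates of a frame,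
  with conjugacy as a pointwise identity in these coordinates; a conditional law is then recognised
  by comparing two iterated integrals. A second obstacle is that \<open>gaussian\<close>,
  \<open>affine_lebesgue\<close> and \<open>student\<close> choose a square root, a basis and
  eigenvalues by \<open>SOME\<close>. Each choice is made harmless by comparing orthonormal families
  with equal span or equal quadratic form. The mean \<open>xt b\<close> comes from a projection:
  \<open>V ** matrix_inv (transpose V ** A ** V) ** transpose V ** A\<close> is the identity on the
  range of \<open>V\<close> and kills \<open>Y\<close>. The condition on \<open>x\<close> thus fixes
  the part \<open>x0 + V u\<close>, whose value is \<open>xt b\<close>, and leaves the coefficients
  along \<open>Y\<close> free. The parameters \<open>2 * \<alpha>t\<close> and
  \<open>\<beta>t z / \<alpha>t\<close> are those for which the Student normaliser is a ratio of two
  inverse gamma normalisers.\<close>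

abbreviation leb :: "'i set \<Rightarrow> ('i \<Rightarrow> real) measure" where
  "leb I \<equiv> Pi\<^sub>M I (\<lambda>_. lborel)"

interpretation leb: product_sigma_finite "\<lambda>_. lborel :: real measure"
  by standard

lemma sigma_finite_leb: "finite I \<Longrightarrow> sigma_finite_measure (leb I)"
  by (rule leb.sigma_finite)

text \<open>Boxes determine a finite product of sigma-finite measures, and on a box the claim splits
  into the scaling rule of each coordinate. The \<open>restrict\<close> keeps the image among the
  extensional functions, which form the space of \<open>leb I\<close>.\<close>

lemma nn_integral_leb_affine:
  fixes a c :: "'i \<Rightarrow> real"
  assumes I: "finite I" and a: "\<And>i. i \<in> I \<Longrightarrow> a i \<noteq> 0"
    and f [measurable]: "f \<in> borel_measurable (leb I)"
  shows "(\<integral>\<^sup>+y. f y \<partial>leb I) =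
    (\<Prod>i\<in>I. ennreal \<bar>a i\<bar>) * (\<integral>\<^sup>+y. f (\<lambda>i\<in>I. c i + a i * y i) \<partial>leb I)"
proof -
  let ?T = "\<lambda>y. \<lambda>i\<in>I. c i + a i * y i"
  have T [measurable]: "?T \<in> leb I \<rightarrow>\<^sub>M leb I"
    by (intro measurable_restrict) measurable
  have "density (distr (leb I) (leb I) ?T) (\<lambda>_. \<Prod>i\<in>I. ennreal \<bar>a i\<bar>) = leb I"
  proof (rule leb.PiM_eqI[OF I])
    fix A :: "'i \<Rightarrow> real set" assume A: "\<And>i. i \<in> I \<Longrightarrow> A i \<in> sets lborel"
    have PA: "Pi\<^sub>E I A \<in> sets (leb I)"
      using A I by (intro sets_PiM_I_finite) auto
    have vim: "?T -` Pi\<^sub>E I A \<inter> space (leb I) = (\<Pi>\<^sub>E i\<in>I. (\<lambda>x. c i + a i * x) -` A i)"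
      by (auto simp: space_PiM PiE_iff extensional_def)
    have m: "(\<lambda>x. c i + a i * x) -` A i \<in> sets lborel" if "i \<in> I" for i
      using measurable_sets[of "\<lambda>x. c i + a i * x" borel borel "A i"] A[OF that] by simp
    have one: "ennreal \<bar>a i\<bar> * emeasure lborel ((\<lambda>x. c i + a i * x) -` A i) = emeasure lborel (A i)"
      if i: "i \<in> I" for i
    proof -
      have "emeasure lborel (A i) =
          emeasure (density (distr lborel borel (\<lambda>x. c i + a i * x)) (\<lambda>_. ennreal \<bar>a i\<bar>)) (A i)"
        using lborel_real_affine[OF a[OF i], of "c i"] by simp
      also have "\<dots> = ennreal \<bar>a i\<bar> * emeasure lborel ((\<lambda>x. c i + a i * x) -` A i)"
        using A[OF i] by (subst emeasure_density_const) (auto simp: emeasure_distr)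
      finally show ?thesis ..
    qed
    have "emeasure (density (distr (leb I) (leb I) ?T) (\<lambda>_. \<Prod>i\<in>I. ennreal \<bar>a i\<bar>)) (Pi\<^sub>E I A) =
        (\<Prod>i\<in>I. ennreal \<bar>a i\<bar>) * emeasure (leb I) (?T -` Pi\<^sub>E I A \<inter> space (leb I))"
      using PA by (subst emeasure_density_const) (auto simp: emeasure_distr)
    also have "\<dots> = (\<Prod>i\<in>I. ennreal \<bar>a i\<bar>) * (\<Prod>i\<in>I. emeasure lborel ((\<lambda>x. c i + a i * x) -` A i))"
      unfolding vim using m by (subst leb.emeasure_PiM[OF I]) auto
    also have "\<dots> = (\<Prod>i\<in>I. emeasure lborel (A i))"
      by (simp add: prod.distrib[symmetric] one)
    finally show "emeasure (density (distr (leb I) (leb I) ?T) (\<lambda>_. \<Prod>i\<in>I. ennreal \<bar>a i\<bar>)) (Pi\<^sub>E I A) =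
      (\<Prod>i\<in>I. emeasure lborel (A i))" .
  qed simp
  then have "(\<integral>\<^sup>+y. f y \<partial>leb I) =
      (\<integral>\<^sup>+y. f y \<partial>density (distr (leb I) (leb I) ?T) (\<lambda>_. \<Prod>i\<in>I. ennreal \<bar>a i\<bar>))"
    by simp
  also have "\<dots> = (\<integral>\<^sup>+y. (\<Prod>i\<in>I. ennreal \<bar>a i\<bar>) * f y \<partial>distr (leb I) (leb I) ?T)"
    by (subst nn_integral_density) auto
  also have "\<dots> = (\<Prod>i\<in>I. ennreal \<bar>a i\<bar>) * (\<integral>\<^sup>+y. f (?T y) \<partial>leb I)"
    by (subst nn_integral_distr) (auto simp: nn_integral_cmult)
  finally show ?thesis .
qed

lemma nn_integral_leb_translate:
  assumes "finite I" "f \<in> borel_measurable (leb I)"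
  shows "(\<integral>\<^sup>+y. f (\<lambda>i\<in>I. c i + y i) \<partial>leb I) = (\<integral>\<^sup>+y. f y \<partial>leb I)"
  using nn_integral_leb_affine[OF assms(1) _ assms(2), of "\<lambda>_. 1" c] by simp

lemma nn_integral_leb_reflect:
  assumes "finite I" "f \<in> borel_measurable (leb I)"
  shows "(\<integral>\<^sup>+y. f (\<lambda>i\<in>I. c i - y i) \<partial>leb I) = (\<integral>\<^sup>+y. f y \<partial>leb I)"
  using nn_integral_leb_affine[OF assms(1) _ assms(2), of "\<lambda>_. -1" c] by simp

definition orthonormal_on :: "'i set \<Rightarrow> ('i \<Rightarrow> 'a::euclidean_space) \<Rightarrow> bool" where
  "orthonormal_on I B \<longleftrightarrow> (\<forall>i\<in>I. \<forall>j\<in>I. B i \<bullet> B j = (if i = j then 1 else 0))"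

text \<open>Values of \<open>y\<close> outside \<open>I\<close> are ignored, so extensional and
  arbitrary functions can be mixed as coefficients. The family is indexed by any set because
  \<open>Basis\<close>, initial segments of the naturals and segments above \<open>p\<close> all
  occur.\<close>

definition lincomb :: "'i set \<Rightarrow> ('i \<Rightarrow> 'a::euclidean_space) \<Rightarrow> ('i \<Rightarrow> real) \<Rightarrow> 'a" where
  "lincomb I B y = (\<Sum>i\<in>I. y i *\<^sub>R B i)"

lemma measurable_lincomb [measurable]: "lincomb I B \<in> borel_measurable (leb I)"
  unfolding lincomb_def by measurable

lemma lincomb_cong: "(\<And>i. i \<in> I \<Longrightarrow> y i = z i) \<Longrightarrow> lincomb I B y = lincomb I B z"
  unfolding lincomb_def by (intro sum.cong) auto

lemma lincomb_restrict [simp]: "lincomb I B (restrict y I) = lincomb I B y"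
  by (rule lincomb_cong) simp

lemma lincomb_add: "lincomb I B (\<lambda>i. y i + z i) = lincomb I B y + lincomb I B z"
  unfolding lincomb_def by (simp add: scaleR_add_left sum.distrib)

lemma lincomb_diff: "lincomb I B (\<lambda>i. y i - z i) = lincomb I B y - lincomb I B z"
  unfolding lincomb_def by (simp add: scaleR_diff_left sum_subtractf)

lemma lincomb_in_span: "lincomb I B y \<in> span (B ` I)"
  unfolding lincomb_def by (intro span_sum span_scale span_base) auto

lemma linear_lincomb: "linear T \<Longrightarrow> T (lincomb I B y) = lincomb I (\<lambda>i. T (B i)) y"
  unfolding lincomb_def by (simp add: linear_sum linear_cmul)

lemma orthonormal_lincomb_inner:
  assumes "finite I" "orthonormal_on I B" "i \<in> I"
  shows "lincomb I B y \<bullet> B i = y i"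
proof -
  have "lincomb I B y \<bullet> B i = (\<Sum>j\<in>I. y j * (B j \<bullet> B i))"
    unfolding lincomb_def by (simp add: inner_sum_left)
  also have "\<dots> = (\<Sum>j\<in>I. if j = i then y j else 0)"
    using assms by (intro sum.cong) (auto simp: orthonormal_on_def)
  finally show ?thesis using assms by simp
qed

lemma orthonormal_inner_lincomb:
  assumes "finite I" "orthonormal_on I B"
  shows "lincomb I B y \<bullet> lincomb I B y = (\<Sum>i\<in>I. (y i)\<^sup>2)"
proof -
  have "lincomb I B y \<bullet> lincomb I B y = (\<Sum>i\<in>I. y i * (lincomb I B y \<bullet> B i))"
    by (subst (2) lincomb_def) (simp add: inner_sum_right)
  also have "\<dots> = (\<Sum>i\<in>I. (y i)\<^sup>2)"
    using assms by (intro sum.cong) (auto simp: orthonormal_lincomb_inner power2_eq_square)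
  finally show ?thesis .
qed

lemma span_image_lincomb:
  assumes "finite I" "v \<in> span (B ` I)"
  obtains y where "v = lincomb I B y"
  using assms(2)
proof (induction arbitrary: thesis rule: span_induct_alt)
  case base
  have "0 = lincomb I B (\<lambda>_. 0)" by (simp add: lincomb_def)
  then show ?case by (rule base)
next
  case (step c x w)
  from step obtain y where y: "w = lincomb I B y" by blast
  from step obtain i where i: "i \<in> I" "x = B i" by blast
  have "lincomb I B (\<lambda>j. if j = i then c else 0) = c *\<^sub>R x"
    unfolding lincomb_def using i assms(1) by (simp add: if_distrib[of "\<lambda>t. t *\<^sub>R _"] cong: if_cong)
  then have "c *\<^sub>R x + w = lincomb I B (\<lambda>j. (if j = i then c else 0) + y j)"
    by (simp add: lincomb_add y)
  then show ?case by (rule step.prems)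
qed

lemma orthonormal_span_expansion:
  assumes "finite I" "orthonormal_on I B" "v \<in> span (B ` I)"
  shows "v = lincomb I B (\<lambda>i. v \<bullet> B i)"
proof -
  from span_image_lincomb[OF assms(1,3)] obtain y where y: "v = lincomb I B y" .
  show ?thesis
    by (subst y, rule lincomb_cong) (simp add: y orthonormal_lincomb_inner[OF assms(1,2)])
qed

lemma nn_integral_leb_std_normal:
  assumes I: "finite I"
  shows "(\<integral>\<^sup>+y. ennreal (\<Prod>i\<in>I. std_normal_density (y i)) \<partial>leb I) = 1"
proof -
  have "(\<integral>\<^sup>+y. ennreal (\<Prod>i\<in>I. std_normal_density (y i)) \<partial>leb I) =
      (\<integral>\<^sup>+y. (\<Prod>i\<in>I. ennreal (std_normal_density (y i))) \<partial>leb I)"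
    by (simp add: prod_ennreal)
  also have "\<dots> = (\<Prod>i\<in>I. \<integral>\<^sup>+t. ennreal (std_normal_density t) \<partial>lborel)"
    using I by (subst leb.product_nn_integral_prod) auto
  also have "(\<integral>\<^sup>+t. ennreal (std_normal_density t) \<partial>lborel) = 1"
    by (subst nn_integral_eq_integral) auto
  finally show ?thesis by simp
qed

text \<open>The right-hand side depends on the point \<open>lincomb I B y\<close> alone. This
  rotation invariance lets one Gaussian weight serve two frames.\<close>

lemma prod_std_normal_density:
  assumes "finite I" "orthonormal_on I B"
  shows "(\<Prod>i\<in>I. std_normal_density (y i)) =
    (1 / sqrt (2 * pi)) ^ card I * exp (- (lincomb I B y \<bullet> lincomb I B y) / 2)"
  unfolding orthonormal_inner_lincomb[OF assms] std_normal_density_def prod.distrib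
  using assms(1) by (simp add: exp_sum[symmetric] sum_negf sum_divide_distrib)

text \<open>The uniqueness argument for Haar measure, on the common span: both sides are invariant
  under its translations, and the standard Gaussian fixes the constant.\<close>

lemma nn_integral_orthonormal_eq:
  fixes B :: "'i \<Rightarrow> 'a::euclidean_space" and B' :: "'j \<Rightarrow> 'a"
  assumes I: "finite I" and J: "finite J" and card: "card I = card J"
    and B: "orthonormal_on I B" and B': "orthonormal_on J B'"
    and span: "span (B ` I) = span (B' ` J)"
    and f [measurable]: "f \<in> borel_measurable borel"
  shows "(\<integral>\<^sup>+y. f (lincomb I B y) \<partial>leb I) = (\<integral>\<^sup>+z. f (lincomb J B' z) \<partial>leb J)"
proof -
  let ?e = "lincomb I B" and ?e' = "lincomb J B'"
  define g :: "'a \<Rightarrow> ennreal" where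
    "g v = ennreal ((1 / sqrt (2 * pi)) ^ card I * exp (- (v \<bullet> v) / 2))" for v
  have [measurable]: "g \<in> borel_measurable borel"
    unfolding g_def by measurable
  have g1: "(\<integral>\<^sup>+y. g (?e y) \<partial>leb I) = 1"
    using nn_integral_leb_std_normal[OF I] by (simp add: g_def prod_std_normal_density[OF I B])
  have g2: "(\<integral>\<^sup>+z. g (?e' z) \<partial>leb J) = 1"
    using nn_integral_leb_std_normal[OF J] by (simp add: g_def prod_std_normal_density[OF J B'] card)
  interpret LI: sigma_finite_measure "leb I" by (rule sigma_finite_leb[OF I])
  interpret LJ: sigma_finite_measure "leb J" by (rule sigma_finite_leb[OF J])
  interpret P: pair_sigma_finite "leb I" "leb J" ..
  have ex: "?e y = ?e' (\<lambda>j. ?e y \<bullet> B' j)" for y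
    using orthonormal_span_expansion[OF J B'] lincomb_in_span[of I B y] span by auto
  have ex': "?e' z = ?e (\<lambda>i. ?e' z \<bullet> B i)" for z
    using orthonormal_span_expansion[OF I B] lincomb_in_span[of J B' z] span by auto
  \<comment> \<open>By \<open>ex\<close>, adding \<open>?e y\<close> to \<open>?e' z\<close> is a
    translation of the coordinates \<open>z\<close>; this is where the equality of the spans
    enters.\<close>
  have tr: "(\<integral>\<^sup>+z. h (?e y + ?e' z) \<partial>leb J) = (\<integral>\<^sup>+z. h (?e' z) \<partial>leb J)"
    if [measurable]: "h \<in> borel_measurable borel" for h :: "'a \<Rightarrow> ennreal" and y
    using nn_integral_leb_translate[OF J, of "\<lambda>z. h (?e' z)" "\<lambda>j. ?e y \<bullet> B' j"]
    by (simp add: lincomb_add ex[symmetric])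
  have rf: "(\<integral>\<^sup>+z. h (?e y - ?e' z) \<partial>leb J) = (\<integral>\<^sup>+z. h (?e' z) \<partial>leb J)"
    if [measurable]: "h \<in> borel_measurable borel" for h :: "'a \<Rightarrow> ennreal" and y
    using nn_integral_leb_reflect[OF J, of "\<lambda>z. h (?e' z)" "\<lambda>j. ?e y \<bullet> B' j"]
    by (simp add: lincomb_diff ex[symmetric])
  have tr': "(\<integral>\<^sup>+y. h (?e y) \<partial>leb I) = (\<integral>\<^sup>+y. h (?e y + ?e' z) \<partial>leb I)"
    if [measurable]: "h \<in> borel_measurable borel" for h :: "'a \<Rightarrow> ennreal" and z
    using nn_integral_leb_translate[OF I, of "\<lambda>z. h (?e z)" "\<lambda>i. ?e' z \<bullet> B i"]
    by (simp add: lincomb_add ex'[symmetric] add.commute)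
  have "(\<integral>\<^sup>+y. f (?e y) \<partial>leb I) = (\<integral>\<^sup>+y. (\<integral>\<^sup>+z. f (?e y) * g (?e y + ?e' z) \<partial>leb J) \<partial>leb I)"
    by (simp add: nn_integral_cmult tr g2)
  \<comment> \<open>The inserted factor \<open>g (?e y + ?e' z)\<close> has integral 1 in
    \<open>z\<close>. After the exchange, shifting \<open>y\<close> by \<open>- ?e' z\<close> moves
    the coupling from \<open>g\<close> to \<open>f\<close>. After a second exchange, a reflection in
    \<open>z\<close> uncouples \<open>f\<close>, and \<open>g\<close> integrates to 1 in
    \<open>y\<close>.\<close>
  also have "\<dots> = (\<integral>\<^sup>+z. (\<integral>\<^sup>+y. f (?e y) * g (?e y + ?e' z) \<partial>leb I) \<partial>leb J)"
    by (rule P.Fubini'[symmetric]) measurable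
  also have "\<dots> = (\<integral>\<^sup>+z. (\<integral>\<^sup>+y. f (?e y - ?e' z) * g (?e y) \<partial>leb I) \<partial>leb J)"
    using tr'[of "\<lambda>v. f (v - ?e' z) * g v" z for z] by simp
  also have "\<dots> = (\<integral>\<^sup>+y. (\<integral>\<^sup>+z. f (?e y - ?e' z) * g (?e y) \<partial>leb J) \<partial>leb I)"
    by (rule P.Fubini') measurable
  also have "\<dots> = (\<integral>\<^sup>+z. f (?e' z) \<partial>leb J)"
    by (simp add: nn_integral_multc rf nn_integral_cmult g1)
  finally show ?thesis .
qed

section \<open>Frames with the same quadratic form\<close>

lemma orthonormal_on_Basis: "orthonormal_on Basis (\<lambda>b. b)"
  by (auto simp: orthonormal_on_def inner_Basis)

lemma inner_eq_sum_Basis: "v \<bullet> v = (\<Sum>b\<in>Basis. (b \<bullet> v)\<^sup>2)" for v :: "'a::euclidean_space"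
  by (subst euclidean_inner) (simp add: power2_eq_square inner_commute)

text \<open>The residual of \<open>w\<close> after projection onto the family has nonnegative
  squared norm.\<close>

lemma bessel:
  assumes "finite J" "orthonormal_on J U"
  shows "(\<Sum>j\<in>J. (w \<bullet> U j)\<^sup>2) \<le> w \<bullet> w"
proof -
  let ?p = "lincomb J U (\<lambda>j. w \<bullet> U j)"
  have "0 \<le> (w - ?p) \<bullet> (w - ?p)" by simp
  also have "\<dots> = w \<bullet> w - 2 * (w \<bullet> ?p) + ?p \<bullet> ?p"
    by (simp add: inner_diff inner_commute algebra_simps)
  also have "w \<bullet> ?p = (\<Sum>j\<in>J. (w \<bullet> U j)\<^sup>2)"
    by (simp add: lincomb_def inner_sum_right power2_eq_square)
  finally show ?thesis by (simp add: orthonormal_inner_lincomb[OF assms])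
qed

text \<open>The trace of the quadratic form makes the mean of \<open>B i \<bullet> B i\<close> equal to \<open>1\<close>,
  while Bessel's inequality bounds each of these numbers by \<open>1\<close>.\<close>

lemma orthonormal_on_same_form:
  fixes B :: "'i \<Rightarrow> 'a::euclidean_space" and U :: "'j \<Rightarrow> 'a"
  assumes I: "finite I" and J: "finite J" and card: "card I = card J" and U: "orthonormal_on J U"
    and eq: "\<And>w. (\<Sum>i\<in>I. (w \<bullet> B i)\<^sup>2) = (\<Sum>j\<in>J. (w \<bullet> U j)\<^sup>2)"
  shows "orthonormal_on I B"
proof -
  have "(\<Sum>i\<in>I. B i \<bullet> B i) = (\<Sum>b\<in>Basis. \<Sum>i\<in>I. (b \<bullet> B i)\<^sup>2)"
    by (subst sum.swap) (simp add: inner_eq_sum_Basis)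
  also have "\<dots> = (\<Sum>j\<in>J. U j \<bullet> U j)"
    unfolding eq by (subst sum.swap) (simp add: inner_eq_sum_Basis)
  also have "\<dots> = real (card I)"
    using U card by (simp add: orthonormal_on_def)
  finally have sum: "(\<Sum>i\<in>I. 1 - B i \<bullet> B i) = 0" by (simp add: sum_subtractf)
  \<comment> \<open>Taking \<open>w = B i\<close> in \<open>eq\<close> turns Bessel's inequality for
    \<open>U\<close> into a bound on a row of the Gram matrix of \<open>B\<close>. The diagonal
    entry \<open>t\<close> then satisfies \<open>t\<^sup>2 \<le> t\<close>, and once it is 1 no room
    is left for the other entries of the row.\<close>
  have row: "(\<Sum>j\<in>I. (B i \<bullet> B j)\<^sup>2) \<le> B i \<bullet> B i" if "i \<in> I" for i
    using bessel[OF J U, of "B i"] eq[of "B i"] by simp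
  have split: "(\<Sum>j\<in>I. (B i \<bullet> B j)\<^sup>2) = (B i \<bullet> B i)\<^sup>2 + (\<Sum>j\<in>I - {i}. (B i \<bullet> B j)\<^sup>2)"
    if "i \<in> I" for i using that I by (simp add: sum.remove)
  have le: "B i \<bullet> B i \<le> 1" if i: "i \<in> I" for i
  proof (rule ccontr)
    assume "\<not> ?thesis"
    then have "1 < B i \<bullet> B i" by simp
    from power_strict_increasing[OF _ this, of 1 2]
    have "B i \<bullet> B i < (B i \<bullet> B i)\<^sup>2" by simp
    moreover have "0 \<le> (\<Sum>j\<in>I - {i}. (B i \<bullet> B j)\<^sup>2)" by (intro sum_nonneg) auto
    ultimately show False using row[OF i] split[OF i] by linarith
  qed
  have one: "B i \<bullet> B i = 1" if "i \<in> I" for i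
    using sum_nonneg_eq_0_iff[OF I, of "\<lambda>i. 1 - B i \<bullet> B i"] le sum that by auto
  have zero: "B i \<bullet> B j = 0" if "i \<in> I" "j \<in> I" "i \<noteq> j" for i j
  proof -
    have "(\<Sum>j\<in>I - {i}. (B i \<bullet> B j)\<^sup>2) \<le> 0"
      using row[OF that(1)] split[OF that(1)] one[OF that(1)] by simp
    then have "(\<Sum>j\<in>I - {i}. (B i \<bullet> B j)\<^sup>2) = 0"
      by (intro antisym sum_nonneg) auto
    then show ?thesis
      using sum_nonneg_eq_0_iff[of "I - {i}" "\<lambda>j. (B i \<bullet> B j)\<^sup>2"] I that by auto
  qed
  show ?thesis using one zero by (auto simp: orthonormal_on_def)
qed

text \<open>The part of \<open>B i\<close> orthogonal to all \<open>U j\<close> makes the right-hand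
  form vanish, hence the left-hand one. It is therefore orthogonal to \<open>B i\<close> as well as
  to its projection, so it is zero.\<close>

lemma orthonormal_same_form_subset:
  assumes I: "finite I" and J: "finite J" and U: "orthonormal_on J U"
    and eq: "\<And>w. (\<Sum>i\<in>I. (w \<bullet> B i)\<^sup>2) = (\<Sum>j\<in>J. (w \<bullet> U j)\<^sup>2)"
  shows "B ` I \<subseteq> span (U ` J)"
proof clarify
  fix i assume i: "i \<in> I"
  let ?p = "lincomb J U (\<lambda>j. B i \<bullet> U j)"
  let ?w = "B i - ?p"
  have w: "?w \<bullet> U j = 0" if "j \<in> J" for j
    using that by (simp add: inner_diff_left orthonormal_lincomb_inner[OF J U])
  have "(\<Sum>i\<in>I. (?w \<bullet> B i)\<^sup>2) = 0" unfolding eq using w by simp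
  then have "?w \<bullet> B i = 0"
    using sum_nonneg_eq_0_iff[OF I, of "\<lambda>i. (?w \<bullet> B i)\<^sup>2"] i by auto
  moreover have "?w \<bullet> ?p = 0"
    unfolding lincomb_def inner_sum_right using w by (simp add: lincomb_def)
  ultimately have "?w \<bullet> ?w = 0" by (simp add: inner_diff_right)
  then have "B i = ?p" by simp
  then show "B i \<in> span (U ` J)" using lincomb_in_span by metis
qed

lemma orthonormal_same_form_span:
  assumes "finite I" "finite J" "orthonormal_on J U" "orthonormal_on I B"
    and eq: "\<And>w. (\<Sum>i\<in>I. (w \<bullet> B i)\<^sup>2) = (\<Sum>j\<in>J. (w \<bullet> U j)\<^sup>2)"
  shows "span (B ` I) = span (U ` J)"
  using orthonormal_same_form_subset[OF assms(1,2,3) eq]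
    orthonormal_same_form_subset[OF assms(2,1,4) eq[symmetric]]
  by (simp add: span_eq)

section \<open>Spectral theorem, square roots and pseudoinverses\<close>

text \<open>This is the first-order condition at an extremum, in algebraic form: near 0 the linear
  term would win over the quadratic one.\<close>

lemma nonneg_quadratic_imp_linear_zero:
  fixes b c :: real
  assumes "\<And>t. 0 \<le> 2 * t * b + t\<^sup>2 * c"
  shows "b = 0"
proof (rule ccontr)
  assume b: "b \<noteq> 0"
  have c: "0 \<le> c" using assms[of 1] assms[of "-1"] by simp
  \<comment> \<open>The \<open>+ 1\<close> keeps the denominator positive even for
    \<open>c = 0\<close>.\<close>
  define t where "t = - b / (c + 1)"
  have bt: "b = - (t * (c + 1))" using c by (simp add: t_def)
  have "0 \<le> 2 * t * b + t\<^sup>2 * c" by (rule assms)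
  also have "\<dots> = - (t\<^sup>2 * (c + 2))"
    unfolding bt by (simp add: algebra_simps power2_eq_square)
  also have "\<dots> < 0" using bt b c by simp
  finally show False by simp
qed

text \<open>The Rayleigh quotient attains its maximum on the unit sphere of \<open>S\<close>, which
  is compact. At a maximiser \<open>u\<close> the first-order condition makes
  \<open>c *\<^sub>R u - f u\<close> orthogonal to \<open>S\<close>; by invariance it lies in
  \<open>S\<close> and is therefore zero.\<close>

lemma selfadjoint_eigenvector:
  fixes f :: "'a::euclidean_space \<Rightarrow> 'a"
  assumes f: "linear f" and sa: "\<And>x y. f x \<bullet> y = x \<bullet> f y"
    and S: "subspace S" and inv: "\<And>x. x \<in> S \<Longrightarrow> f x \<in> S" and dim: "dim S \<noteq> 0"
  obtains u c where "u \<in> S" "u \<bullet> u = 1" "f u = c *\<^sub>R u"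
proof -
  let ?K = "sphere 0 1 \<inter> S"
  have "compact ?K"
    using closed_subspace[OF S] by (intro compact_Int_closed) auto
  moreover have "?K \<noteq> {}"
  proof -
    from dim S obtain x where x: "x \<in> S" "x \<noteq> 0"
      by (metis dim_eq_0 subsetI singletonI)
    then have "x /\<^sub>R norm x \<in> ?K" using S by (simp add: subspace_scale)
    then show ?thesis by blast
  qed
  moreover have "continuous_on ?K (\<lambda>x. x \<bullet> f x)"
    using f by (intro continuous_intros linear_continuous_on linear_linear[THEN iffD2])
  ultimately obtain u where u: "u \<in> ?K" and max: "\<And>x. x \<in> ?K \<Longrightarrow> x \<bullet> f x \<le> u \<bullet> f u"
    by (metis continuous_attains_sup)
  define c where "c = u \<bullet> f u"
  have uu: "u \<bullet> u = 1" and uS: "u \<in> S" using u by (auto simp: norm_eq_1)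
  \<comment> \<open>Homogeneity extends the bound from unit vectors to all of
    \<open>S\<close>.\<close>
  have le: "x \<bullet> f x \<le> c * (x \<bullet> x)" if "x \<in> S" for x
  proof (cases "x = 0")
    case False
    have "x /\<^sub>R norm x \<in> ?K" using S False that by (simp add: subspace_scale)
    from max[OF this] have "x \<bullet> f x / (norm x)\<^sup>2 \<le> c"
      using f by (simp add: c_def linear_cmul power2_eq_square divide_inverse mult_ac)
    then show ?thesis using False by (simp add: field_simps power2_norm_eq_inner)
  qed (simp add: linear_0[OF f])
  \<comment> \<open>The inequality \<open>le\<close> along the line \<open>u + t *\<^sub>R v\<close>
    is an equality at \<open>t = 0\<close>, so only terms of first and second order in
    \<open>t\<close> remain.\<close>
  have orth: "(c *\<^sub>R u - f u) \<bullet> v = 0" if v: "v \<in> S" for v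
  proof (rule nonneg_quadratic_imp_linear_zero)
    fix t
    have "0 \<le> c * ((u + t *\<^sub>R v) \<bullet> (u + t *\<^sub>R v)) - (u + t *\<^sub>R v) \<bullet> f (u + t *\<^sub>R v)"
      using le[of "u + t *\<^sub>R v"] S uS v by (simp add: subspace_add subspace_scale)
    also have "(u + t *\<^sub>R v) \<bullet> (u + t *\<^sub>R v) = 1 + 2 * t * (u \<bullet> v) + t\<^sup>2 * (v \<bullet> v)"
      using uu inner_commute[of v u] by (simp add: inner_add_left inner_add_right power2_eq_square algebra_simps)
    also have "(u + t *\<^sub>R v) \<bullet> f (u + t *\<^sub>R v) = c + 2 * t * (f u \<bullet> v) + t\<^sup>2 * (v \<bullet> f v)"
      using sa[of u v] inner_commute[of v "f u"]
      by (simp add: linear_add[OF f] linear_cmul[OF f] inner_add_left inner_add_right c_def power2_eq_square algebra_simps)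
    also have "c * (1 + 2 * t * (u \<bullet> v) + t\<^sup>2 * (v \<bullet> v)) - (c + 2 * t * (f u \<bullet> v) + t\<^sup>2 * (v \<bullet> f v)) =
        2 * t * ((c *\<^sub>R u - f u) \<bullet> v) + t\<^sup>2 * (c * (v \<bullet> v) - v \<bullet> f v)"
      by (simp add: inner_diff_left algebra_simps)
    finally show "0 \<le> 2 * t * ((c *\<^sub>R u - f u) \<bullet> v) + t\<^sup>2 * (c * (v \<bullet> v) - v \<bullet> f v)" .
  qed
  have "c *\<^sub>R u - f u \<in> S"
    using S uS inv by (simp add: subspace_diff subspace_scale)
  from orth[OF this] have "f u = c *\<^sub>R u" by simp
  with uS uu show ?thesis by (rule that)
qed

text \<open>Splitting off one eigenvector leaves its orthogonal complement within \<open>S\<close>,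
  invariant by self-adjointness and of dimension one less. The split-off vector gets index
  \<open>r\<close>, since the induction hypothesis fills the indices below.\<close>

lemma selfadjoint_eigenbasis:
  fixes f :: "'a::euclidean_space \<Rightarrow> 'a"
  assumes f: "linear f" and sa: "\<And>x y. f x \<bullet> y = x \<bullet> f y"
    and "subspace S" "\<And>x. x \<in> S \<Longrightarrow> f x \<in> S" "dim S = r"
  shows "\<exists>U d. orthonormal_on {..<r} U \<and> U ` {..<r} \<subseteq> S \<and> (\<forall>i<r. f (U i) = d i *\<^sub>R U i)"
  using assms(3-)
proof (induction r arbitrary: S)
  case 0
  then show ?case by (simp add: orthonormal_on_def)
next
  case (Suc r)
  obtain u c where u: "u \<in> S" "u \<bullet> u = 1" "f u = c *\<^sub>R u"
    using selfadjoint_eigenvector[OF f sa Suc.prems(1,2)] Suc.prems(3) by auto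
  define S' where "S' = {y \<in> S. \<forall>x \<in> span {u}. orthogonal x y}"
  have S'_eq: "S' = {y \<in> S. u \<bullet> y = 0}"
    unfolding S'_def by (auto simp: span_singleton orthogonal_def intro!: exI[of _ 1])
  have "subspace S'"
    unfolding S'_eq using Suc.prems(1) by (auto simp: subspace_def inner_add_right)
  moreover have "f x \<in> S'" if "x \<in> S'" for x
    using that sa[of u x] u Suc.prems(2) by (auto simp: S'_eq)
  moreover have "dim S' = r"
  proof -
    have "dim S' + dim (span {u}) = dim S"
      unfolding S'_def using u Suc.prems(1)
      by (intro dim_subspace_orthogonal_to_vectors) (auto simp: span_minimal)
    moreover have "dim (span {u}) = 1"
      using u(2) by (auto simp: dim_singleton)
    ultimately show ?thesis using Suc.prems(3) by simp
  qed
  ultimately obtain U d where U: "orthonormal_on {..<r} U" "U ` {..<r} \<subseteq> S'"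
    "\<forall>i<r. f (U i) = d i *\<^sub>R U i"
    using Suc.IH by blast
  have uU: "u \<bullet> U i = 0" if "i < r" for i using U(2) that by (auto simp: S'_eq)
  have "orthonormal_on {..<Suc r} (U(r := u))"
    using U(1) u(2) uU by (auto simp: orthonormal_on_def less_Suc_eq inner_commute)
  moreover have "(U(r := u)) ` {..<Suc r} \<subseteq> S"
    using U(2) u(1) by (auto simp: S'_eq less_Suc_eq image_subset_iff)
  moreover have "\<forall>i<Suc r. f ((U(r := u)) i) = (d(r := c)) i *\<^sub>R (U(r := u)) i"
    using U(3) u(3) by (auto simp: less_Suc_eq)
  ultimately show ?case by blast
qed

lemma orthonormal_on_independent:
  assumes I: "finite I" and B: "orthonormal_on I B"
  shows "inj_on B I" "independent (B ` I)"
proof -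
  show "inj_on B I"
    using B by (auto simp: inj_on_def orthonormal_on_def) (metis zero_neq_one)
  show "independent (B ` I)"
    using B by (intro pairwise_orthogonal_independent)
      (auto simp: pairwise_def orthogonal_def orthonormal_on_def split: if_splits)
qed

lemma orthonormal_on_span_eq:
  assumes I: "finite I" and B: "orthonormal_on I B" and S: "subspace S"
    and sub: "B ` I \<subseteq> S" and card: "card I = dim S"
  shows "span (B ` I) = S"
proof (rule subspace_dim_equal)
  show "dim S \<le> dim (span (B ` I))"
    using orthonormal_on_independent[OF I B] card by (simp add: dim_eq_card_independent card_image)
qed (use sub S in \<open>auto simp: span_minimal\<close>)

lemma orthonormal_cols_iff: "orthonormal_cols p U \<longleftrightarrow> orthonormal_on {..<p} U"
  by (auto simp: orthonormal_cols_def orthonormal_on_def)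

lemma cols_diag_cols_mult: "cols_diag_cols p Y d *v w = lincomb {..<p} Y (\<lambda>l. d l * (w \<bullet> Y l))"
  by (simp add: cols_diag_cols_def lincomb_def matrix_vector_mult_def vec_eq_iff inner_vec_def
      sum_distrib_left sum_distrib_right sum.swap[of _ "{..<p}" UNIV] mult_ac)

lemma inner_cols_diag_cols: "v \<bullet> (cols_diag_cols p Y d *v w) = (\<Sum>l<p. d l * (v \<bullet> Y l) * (w \<bullet> Y l))"
  by (simp add: cols_diag_cols_mult lincomb_def inner_sum_right mult_ac)

lemma transpose_cols_diag_cols [simp]: "transpose (cols_diag_cols p Y d) = cols_diag_cols p Y d"
  by (simp add: transpose_def cols_diag_cols_def vec_eq_iff mult_ac)

lemma cols_diag_cols_scaleR: "c *\<^sub>R cols_diag_cols p Y d = cols_diag_cols p Y (\<lambda>l. c * d l)"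
  by (simp add: cols_diag_cols_def vec_eq_iff sum_distrib_left mult_ac)

text \<open>Orthonormality cancels the middle factor \<open>U\<^sup>T U\<close>, so products are
  computed on the diagonals. Square root and pseudoinverse are both obtained in this way.\<close>

lemma cols_diag_cols_comp:
  assumes "orthonormal_cols p U"
  shows "cols_diag_cols p U d ** cols_diag_cols p U e = cols_diag_cols p U (\<lambda>i. d i * e i)"
proof (rule matrix_eq[THEN iffD2], rule allI)
  fix w :: "real ^ 'a"
  have "lincomb {..<p} U y \<bullet> U i = y i" if "i < p" for y i
    using assms that by (intro orthonormal_lincomb_inner) (auto simp: orthonormal_cols_iff)
  then show "(cols_diag_cols p U d ** cols_diag_cols p U e) *v w = cols_diag_cols p U (\<lambda>i. d i * e i) *v w"
    unfolding matrix_vector_mul_assoc[symmetric] cols_diag_cols_mult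
    by (intro lincomb_cong) simp
qed

lemma symmetric_matrix_inner: "transpose S = S \<Longrightarrow> (S *v x) \<bullet> y = x \<bullet> (S *v y)"
  for S :: "real ^ 'n ^ 'n"
  by (metis transpose_matrix_vector dot_lmul_matrix)

text \<open>Diagonalising on the range of \<open>S\<close> gives exactly \<open>rank S\<close>
  columns. No eigenvalue is zero there: if \<open>u = S *v w\<close> and \<open>S *v u = 0\<close>,
  then \<open>u \<bullet> u = w \<bullet> (S *v u) = 0\<close>.\<close>

lemma spectral_decomposition_exists:
  fixes S :: "real ^ 'n ^ 'n"
  assumes sym: "transpose S = S" and psd: "\<And>v. 0 \<le> v \<bullet> (S *v v)"
  shows "\<exists>U d. spectral_decomposition S U d"
proof -
  let ?R = "range ((*v) S)"
  have R: "subspace ?R"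
    by (intro linear_subspace_image matrix_vector_mul_linear subspace_UNIV)
  have "\<exists>U d. orthonormal_on {..<rank S} U \<and> U ` {..<rank S} \<subseteq> ?R \<and>
      (\<forall>i<rank S. S *v U i = d i *\<^sub>R U i)"
    using R by (intro selfadjoint_eigenbasis)
      (auto simp: symmetric_matrix_inner[OF sym] rank_dim_range)
  then obtain U d where U: "orthonormal_on {..<rank S} U" "U ` {..<rank S} \<subseteq> ?R"
    and d: "\<And>i. i < rank S \<Longrightarrow> S *v U i = d i *\<^sub>R U i" by blast
  have span: "span (U ` {..<rank S}) = ?R"
    using R U by (intro orthonormal_on_span_eq) (auto simp: rank_dim_range)
  have UU: "U i \<bullet> U i = 1" if "i < rank S" for i
    using U(1) that by (simp add: orthonormal_on_def)
  have "0 < d i" if i: "i < rank S" for i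
  proof -
    have "0 \<le> d i" using psd[of "U i"] d[OF i] UU[OF i] by simp
    moreover have "d i \<noteq> 0"
    proof
      assume "d i = 0"
      then have "S *v U i = 0" using d[OF i] by simp
      moreover obtain w where "U i = S *v w" using U(2) i by blast
      ultimately have "U i \<bullet> U i = 0"
        using symmetric_matrix_inner[OF sym, of w "U i"] by simp
      then show False using UU[OF i] by simp
    qed
    ultimately show ?thesis by simp
  qed
  moreover have "S = cols_diag_cols (rank S) U d"
  proof (rule matrix_eq[THEN iffD2], rule allI)
    fix w
    have "S *v w = lincomb {..<rank S} U (\<lambda>i. (S *v w) \<bullet> U i)"
      using U(1) span by (intro orthonormal_span_expansion) auto
    also have "\<dots> = lincomb {..<rank S} U (\<lambda>i. d i * (w \<bullet> U i))"
      by (intro lincomb_cong) (simp add: symmetric_matrix_inner[OF sym] d)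
    finally show "S *v w = cols_diag_cols (rank S) U d *v w" by (simp add: cols_diag_cols_mult)
  qed
  ultimately show ?thesis
    using U(1) unfolding spectral_decomposition_def orthonormal_cols_iff by blast
qed

text \<open>Each column is \<open>S\<close> applied to that column divided by its eigenvalue; there
  are as many columns as the dimension of the range.\<close>

lemma spectral_decomposition_span:
  fixes S :: "real ^ 'n ^ 'n"
  assumes "spectral_decomposition S U d"
  shows "span (U ` {..<rank S}) = range ((*v) S)"
proof -
  have U: "orthonormal_on {..<rank S} U" and d: "\<And>i. i < rank S \<Longrightarrow> 0 < d i"
    and S: "S = cols_diag_cols (rank S) U d"
    using assms unfolding spectral_decomposition_def orthonormal_cols_iff by auto
  have "U i \<in> range ((*v) S)" if i: "i < rank S" for i
  proof
    have "S *v ((1 / d i) *\<^sub>R U i) = lincomb {..<rank S} U (\<lambda>l. if l = i then 1 else 0)"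
      by (subst S, subst cols_diag_cols_mult, rule lincomb_cong)
        (use U i d[OF i] in \<open>auto simp: orthonormal_on_def\<close>)
    also have "\<dots> = U i"
      using i by (simp add: lincomb_def if_distrib[of "\<lambda>t. t *\<^sub>R _"] cong: if_cong)
    finally show "U i = S *v ((1 / d i) *\<^sub>R U i)" ..
  qed simp
  then show ?thesis
    by (intro orthonormal_on_span_eq U) (auto simp: rank_dim_range intro!: linear_subspace_image)
qed

section \<open>Positive definite matrices, their square roots, and the pseudoinverse\<close>

lemma sym_pos_def_sym: "sym_pos_def A \<Longrightarrow> transpose A = A"
  and sym_pos_def_pos: "sym_pos_def A \<Longrightarrow> v \<noteq> 0 \<Longrightarrow> 0 < v \<bullet> (A *v v)"
  by (auto simp: sym_pos_def_def)

lemma sym_pos_def_nonneg: "sym_pos_def A \<Longrightarrow> 0 \<le> v \<bullet> (A *v v)"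
  by (cases "v = 0") (auto simp: sym_pos_def_def intro: less_imp_le)

lemma sym_pos_def_inj: "sym_pos_def A \<Longrightarrow> A *v v = 0 \<Longrightarrow> v = 0"
  using sym_pos_def_pos by fastforce

lemma sym_pos_def_rank:
  fixes A :: "real ^ 'n ^ 'n"
  assumes "sym_pos_def A"
  shows "rank A = CARD('n)"
  using assms sym_pos_def_inj matrix_nonfull_linear_equations_eq by metis

lemma sym_pos_def_spectral:
  fixes A :: "real ^ 'n ^ 'n"
  assumes "sym_pos_def A"
  obtains U d where "orthonormal_on {..<CARD('n)} U" "span (U ` {..<CARD('n)}) = UNIV"
    "\<And>i. i < CARD('n) \<Longrightarrow> 0 < d i" "A = cols_diag_cols CARD('n) U d"
proof -
  obtain U d where *: "spectral_decomposition A U d"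
    using spectral_decomposition_exists sym_pos_def_sym[OF assms] sym_pos_def_nonneg[OF assms] by blast
  have r: "rank A = CARD('n)" by (rule sym_pos_def_rank[OF assms])
  then have "surj ((*v) A)" using full_rank_surjective by blast
  with spectral_decomposition_span[OF *] r * show ?thesis
    by (intro that[of U d]) (auto simp: spectral_decomposition_def orthonormal_cols_iff)
qed

lemma sym_pos_def_cols_diag_cols:
  fixes U :: "nat \<Rightarrow> real ^ 'n"
  assumes U: "orthonormal_on {..<p} U" "span (U ` {..<p}) = UNIV" and d: "\<And>i. i < p \<Longrightarrow> 0 < d i"
  shows "sym_pos_def (cols_diag_cols p U d)"
  unfolding sym_pos_def_def
proof (intro conjI allI impI)
  fix v :: "real ^ 'n" assume v: "v \<noteq> 0"
  have eq: "v = lincomb {..<p} U (\<lambda>i. v \<bullet> U i)"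
    using U by (intro orthonormal_span_expansion) auto
  have "\<exists>i<p. v \<bullet> U i \<noteq> 0"
    using v by (subst (asm) eq) (auto simp: lincomb_def intro: sum.neutral)
  then obtain i where i: "i < p" "v \<bullet> U i \<noteq> 0" by blast
  have "0 < (\<Sum>l<p. d l * (v \<bullet> U l)\<^sup>2)"
    using d i by (intro sum_pos2[of _ i]) (auto intro!: mult_nonneg_nonneg intro: less_imp_le)
  then show "0 < v \<bullet> (cols_diag_cols p U d *v v)"
    by (simp add: inner_cols_diag_cols power2_eq_square mult_ac)
qed simp

text \<open>An eigenvector \<open>u\<close> of \<open>B\<close> with eigenvalue \<open>d\<close> is
  one of \<open>C\<close>: the vector \<open>w = C u - d u\<close> satisfies
  \<open>C w + d w = C\<^sup>2 u - d\<^sup>2 u = 0\<close>, and \<open>C + d I\<close> is positive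
  definite. Hence \<open>B\<close> and \<open>C\<close> agree on an eigenbasis.\<close>

lemma sym_pos_def_sqrt_unique:
  fixes B C :: "real ^ 'n ^ 'n"
  assumes B: "sym_pos_def B" and C: "sym_pos_def C" and eq: "B ** B = C ** C"
  shows "B = C"
proof -
  obtain U d where U: "orthonormal_on {..<CARD('n)} U" "span (U ` {..<CARD('n)}) = UNIV"
    and d: "\<And>i. i < CARD('n) \<Longrightarrow> 0 < d i" and Bd: "B = cols_diag_cols CARD('n) U d"
    using sym_pos_def_spectral[OF B] by blast
  have ev: "B *v U i = d i *\<^sub>R U i" if i: "i < CARD('n)" for i
  proof -
    have "B *v U i = lincomb {..<CARD('n)} U (\<lambda>l. if l = i then d i else 0)"
      unfolding Bd cols_diag_cols_mult
      by (rule lincomb_cong) (use U(1) i in \<open>auto simp: orthonormal_on_def\<close>)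
    then show ?thesis using i by (simp add: lincomb_def if_distrib[of "\<lambda>t. t *\<^sub>R _"] cong: if_cong)
  qed
  have evC: "C *v U i = d i *\<^sub>R U i" if i: "i < CARD('n)" for i
  proof -
    let ?w = "C *v U i - d i *\<^sub>R U i"
    have "C *v ?w + d i *\<^sub>R ?w = (C ** C) *v U i - (d i * d i) *\<^sub>R U i"
      by (simp add: matrix_vector_mult_diff_distrib matrix_vector_mul_assoc[symmetric]
          matrix_vector_mult_scaleR scaleR_diff_right)
    also have "\<dots> = 0"
      by (simp add: eq[symmetric] matrix_vector_mul_assoc[symmetric] ev[OF i] matrix_vector_mult_scaleR)
    finally have "?w \<bullet> (C *v ?w) + d i * (?w \<bullet> ?w) = 0"
      by (metis inner_add_right inner_scaleR_right inner_zero_right)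
    moreover have "0 \<le> ?w \<bullet> (C *v ?w)" by (rule sym_pos_def_nonneg[OF C])
    moreover have "0 \<le> d i * (?w \<bullet> ?w)" using d[OF i] by (intro mult_nonneg_nonneg) auto
    ultimately have "d i * (?w \<bullet> ?w) = 0" by linarith
    then show ?thesis using d[OF i] by simp
  qed
  show ?thesis
  proof (rule matrix_eq[THEN iffD2], rule allI)
    fix w
    have w: "w = lincomb {..<CARD('n)} U (\<lambda>i. w \<bullet> U i)"
      using U by (intro orthonormal_span_expansion) auto
    have "B *v w = lincomb {..<CARD('n)} (\<lambda>i. B *v U i) (\<lambda>i. w \<bullet> U i)"
      by (subst w, rule linear_lincomb) simp
    also have "\<dots> = lincomb {..<CARD('n)} (\<lambda>i. C *v U i) (\<lambda>i. w \<bullet> U i)"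
      unfolding lincomb_def by (intro sum.cong) (auto simp: ev evC)
    also have "\<dots> = C *v w"
      by (subst (2) w, rule linear_lincomb[symmetric]) simp
    finally show "B *v w = C *v w" .
  qed
qed

lemma matrix_sqrt_correct:
  fixes A :: "real ^ 'n ^ 'n"
  assumes A: "sym_pos_def A"
  shows "sym_pos_def (matrix_sqrt A)" "matrix_sqrt A ** matrix_sqrt A = A"
proof -
  obtain U d where U: "orthonormal_on {..<CARD('n)} U" "span (U ` {..<CARD('n)}) = UNIV"
    and d: "\<And>i. i < CARD('n) \<Longrightarrow> 0 < d i" and Ad: "A = cols_diag_cols CARD('n) U d"
    using sym_pos_def_spectral[OF A] by blast
  let ?B = "cols_diag_cols CARD('n) U (\<lambda>i. sqrt (d i))"
  have "sym_pos_def ?B"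
    using U d by (intro sym_pos_def_cols_diag_cols) auto
  moreover have "?B ** ?B = A"
    unfolding Ad using U(1) d
    by (subst cols_diag_cols_comp) (auto simp: orthonormal_cols_iff cols_diag_cols_def vec_eq_iff
        less_imp_le intro!: sum.cong)
  ultimately have "\<exists>!B. sym_pos_def B \<and> B ** B = A"
    using sym_pos_def_sqrt_unique by metis
  from theI'[OF this] show "sym_pos_def (matrix_sqrt A)" "matrix_sqrt A ** matrix_sqrt A = A"
    unfolding matrix_sqrt_def by auto
qed

text \<open>The square root turns the inner product given by \<open>A\<close> into the ordinary one,
  so that \<open>Y\<^sup>T A Y = I\<close> becomes orthonormality of the images of the
  columns.\<close>

lemma matrix_sqrt_inner:
  assumes "sym_pos_def A"
  shows "(matrix_sqrt A *v v) \<bullet> (matrix_sqrt A *v w) = v \<bullet> (A *v w)"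
  by (metis assms matrix_sqrt_correct matrix_vector_mul_assoc sym_pos_def_sym symmetric_matrix_inner)

text \<open>Transposition exchanges the symmetric factors of \<open>(A ** Y) ** (A ** X)\<close>;
  this product collapses to \<open>A ** X\<close> in one order and to \<open>A ** Y\<close> in the
  other. The same holds with \<open>A\<close> on the right, and then X = X A X = X A Y = Y A
  Y.\<close>

lemma penrose_unique:
  fixes A :: "real ^ 'n ^ 'm"
  assumes X: "A ** X ** A = A" "X ** A ** X = X" "transpose (A ** X) = A ** X" "transpose (X ** A) = X ** A"
    and Y: "A ** Y ** A = A" "Y ** A ** Y = Y" "transpose (A ** Y) = A ** Y" "transpose (Y ** A) = Y ** A"
  shows "X = Y"
proof -
  have "A ** X = (A ** Y) ** (A ** X)" by (metis Y(1) matrix_mul_assoc)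
  also have "\<dots> = transpose ((A ** X) ** (A ** Y))" by (simp only: matrix_transpose_mul[of "A ** X" "A ** Y"] X Y)
  also have "\<dots> = A ** Y" by (metis X(1) Y(3) matrix_mul_assoc)
  finally have AX: "A ** X = A ** Y" .
  have "X ** A = (X ** A) ** (Y ** A)" by (metis Y(1) matrix_mul_assoc)
  also have "\<dots> = transpose ((Y ** A) ** (X ** A))" by (simp only: matrix_transpose_mul[of "Y ** A" "X ** A"] X Y)
  also have "\<dots> = Y ** A" by (metis X(1) Y(4) matrix_mul_assoc)
  finally have XA: "X ** A = Y ** A" .
  show ?thesis by (metis X(2) Y(2) AX XA matrix_mul_assoc)
qed

text \<open>Inverting the eigenvalues satisfies all four equations, which makes the definite
  description meaningful. The equation exported here fixes the quadratic form of
  \<open>pinv S\<close> on the range of a symmetric \<open>S\<close>: at \<open>S *v w\<close> it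
  equals \<open>w \<bullet> (S *v w)\<close>.\<close>

lemma pinv_spectral:
  fixes S :: "real ^ 'n ^ 'n"
  assumes "spectral_decomposition S U d"
  shows "S ** pinv S ** S = S"
proof -
  have U: "orthonormal_cols (rank S) U" and d: "\<And>i. i < rank S \<Longrightarrow> 0 < d i"
    and S: "S = cols_diag_cols (rank S) U d"
    using assms unfolding spectral_decomposition_def by auto
  define r where "r = rank S"
  define X where "X = cols_diag_cols r U (\<lambda>i. 1 / d i)"
  note comp = cols_diag_cols_comp[OF U, folded r_def]
  have S': "S = cols_diag_cols r U d" using S by (simp add: r_def)
  have d': "d i \<noteq> 0" if "i < r" for i using d that by (auto simp: r_def less_imp_neq[symmetric])
  have cong: "cols_diag_cols r U e = cols_diag_cols r U e'" if "\<And>i. i < r \<Longrightarrow> e i = e' i" for e e'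
    using that by (simp add: cols_diag_cols_def)
  have "S ** X ** S = S" "X ** S ** X = X" "transpose (S ** X) = S ** X" "transpose (X ** S) = X ** S"
    unfolding S' X_def comp transpose_cols_diag_cols using d' by (auto intro!: cong)
  then have "\<exists>!X. S ** X ** S = S \<and> X ** S ** X = X \<and> transpose (S ** X) = S ** X \<and> transpose (X ** S) = X ** S"
    by (intro ex1I[of _ X]) (auto intro: penrose_unique)
  from theI'[OF this] show ?thesis unfolding pinv_def by blast
qed

section \<open>Inverse gamma mixtures of normal densities\<close>

definition ig_density :: "real \<Rightarrow> real \<Rightarrow> real \<Rightarrow> real" where
  "ig_density a b s =
     (if 0 < s then b powr a / Gamma a * s powr (- (a + 1)) * exp (- b / s) else 0)"

lemma inverse_gamma_eq: "inverse_gamma a b = density lborel (\<lambda>s. ennreal (ig_density a b s))"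
  by (simp add: inverse_gamma_def ig_density_def)

lemma sets_inverse_gamma [simp, measurable_cong]: "sets (inverse_gamma a b) = sets borel"
  by (simp add: inverse_gamma_eq)

lemma space_inverse_gamma [simp]: "space (inverse_gamma a b) = UNIV"
  by (simp add: inverse_gamma_eq)

lemma measurable_ig_density [measurable (raw)]:
  assumes [measurable]: "f \<in> borel_measurable M" "g \<in> borel_measurable M"
  shows "(\<lambda>x. ig_density a (f x) (g x)) \<in> borel_measurable M"
  unfolding ig_density_def by measurable

lemma ig_density_nonneg: "0 < a \<Longrightarrow> 0 \<le> ig_density a b s"
  by (simp add: ig_density_def Gamma_real_nonneg)

text \<open>Substituting \<open>t = b / s\<close> turns Euler's integral into this one.\<close>

lemma nn_integral_ig_density:
  assumes a: "0 < a" and b: "0 < b"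
  shows "(\<integral>\<^sup>+s. ennreal (ig_density a b s) \<partial>lborel) = 1"
proof -
  let ?f = "\<lambda>t::real. t powr (a - 1) / exp t"
  let ?S = "{0<..} :: real set"
  have "((\<lambda>t. if t \<in> {0<..} then ?f t else 0) has_integral Gamma a) {0..}"
    by (rule has_integral_spike[OF _ _ Gamma_integral_real[OF a], of "{0}"]) auto
  then have G: "(?f has_integral Gamma a) ?S"
    by (subst (asm) has_integral_restrict) auto
  then have "?f absolutely_integrable_on ?S"
    by (intro nonnegative_absolutely_integrable_1) (auto simp: has_integral_iff)
  moreover have img: "(\<lambda>s. b / s) ` ?S = ?S"
  proof (intro equalityI subsetI)
    fix t assume "t \<in> ?S"
    then show "t \<in> (\<lambda>s. b / s) ` ?S" using b by (intro image_eqI[of _ _ "b / t"]) auto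
  qed (use b in auto)
  ultimately have "(\<lambda>s. \<bar>- b / s\<^sup>2\<bar> * ?f (b / s)) absolutely_integrable_on ?S \<and>
      integral ?S (\<lambda>s. \<bar>- b / s\<^sup>2\<bar> * ?f (b / s)) = Gamma a"
    using G b by (subst has_absolute_integral_change_of_variables_1')
      (auto simp: inj_on_def has_integral_iff power2_eq_square intro!: derivative_eq_intros)
  then have "((\<lambda>s. \<bar>- b / s\<^sup>2\<bar> * ?f (b / s)) has_integral Gamma a) ?S"
    by (simp add: has_integral_iff set_lebesgue_integral_eq_integral(1))
  then have int: "((\<lambda>s. (1 / Gamma a) * (\<bar>- b / s\<^sup>2\<bar> * ?f (b / s))) has_integral (1 / Gamma a) * Gamma a) ?S"
    by (rule has_integral_mult_right)
  \<comment> \<open>The Jacobian supplies \<open>b / s\<^sup>2\<close> and Euler's integrand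
    supplies \<open>(b / s) powr (a - 1)\<close>. Together they are
    \<open>b powr a * s powr (- (a + 1))\<close>.\<close>
  have eq: "(1 / Gamma a) * (\<bar>- b / s\<^sup>2\<bar> * ?f (b / s)) = ig_density a b s" if s: "s \<in> ?S" for s
  proof -
    have "b powr a = b * b powr (a - 1)"
      using b by (simp add: powr_mult_base)
    moreover have "s powr (- (a + 1)) = s powr (- 2) * s powr (- (a - 1))"
      by (simp add: powr_add[symmetric] algebra_simps)
    ultimately have "b powr a * s powr (- (a + 1)) = b * b powr (a - 1) * (s powr (- 2) * s powr (- (a - 1)))"
      by simp
    also have "s powr (- 2) = 1 / s\<^sup>2"
      using s by (subst powr_minus_divide) (simp add: powr_numeral)
    also have "s powr (- (a - 1)) = 1 / s powr (a - 1)"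
      by (rule powr_minus_divide)
    also have "b * b powr (a - 1) * (1 / s\<^sup>2 * (1 / s powr (a - 1))) = b / s\<^sup>2 * (b / s) powr (a - 1)"
      using b s by (simp add: powr_divide)
    finally have *: "b powr a * s powr (- (a + 1)) = b / s\<^sup>2 * (b / s) powr (a - 1)" .
    have "ig_density a b s = 1 / Gamma a * (b powr a * s powr (- (a + 1))) * exp (- (b / s))"
      using s by (simp add: ig_density_def)
    also have "\<dots> = 1 / Gamma a * (b / s\<^sup>2 * ((b / s) powr (a - 1) / exp (b / s)))"
      unfolding * exp_minus by (simp add: divide_inverse)
    also have "b / s\<^sup>2 = \<bar>- b / s\<^sup>2\<bar>" using b by simp
    finally show ?thesis ..
  qed
  have "(ig_density a b has_integral (1 / Gamma a) * Gamma a) ?S"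
    by (rule has_integral_eq[OF eq int])
  then have "(ig_density a b has_integral 1) ?S"
    using Gamma_real_pos[OF a] by simp
  then have "(\<integral>\<^sup>+s. ennreal (ig_density a b s) * indicator ?S s \<partial>lborel) = 1"
    using nn_integral_has_integral_lebesgue'[of ?S "ig_density a b" 1] ig_density_nonneg[OF a] by simp
  moreover have "ennreal (ig_density a b s) * indicator ?S s = ennreal (ig_density a b s)" for s
    by (simp add: ig_density_def)
  ultimately show ?thesis by simp
qed

lemma prob_space_inverse_gamma: "0 < a \<Longrightarrow> 0 < b \<Longrightarrow> prob_space (inverse_gamma a b)"
  by (rule prob_spaceI) (simp add: inverse_gamma_eq emeasure_density nn_integral_ig_density)

text \<open>The joint density of \<open>N\<close> centred normal variables with sum of squares \<open>q\<close>, after their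
  variance has been integrated out.\<close>

definition marginal_density :: "real \<Rightarrow> real \<Rightarrow> nat \<Rightarrow> real \<Rightarrow> real" where
  "marginal_density a b N q = (2 * pi) powr (- (N / 2)) * b powr a / Gamma a
     * Gamma (a + N / 2) / (b + q / 2) powr (a + N / 2)"

lemma measurable_marginal_density [measurable (raw)]:
  assumes [measurable]: "f \<in> borel_measurable M" "g \<in> borel_measurable M"
  shows "(\<lambda>x. marginal_density a (f x) N (g x)) \<in> borel_measurable M"
  unfolding marginal_density_def by measurable

lemma marginal_density_nonneg: "0 < a \<Longrightarrow> 0 \<le> marginal_density a b N q"
  by (simp add: marginal_density_def Gamma_real_nonneg)

lemma sqrt_power_powr:
  assumes "0 < x"
  shows "sqrt (x ^ p) = x powr (real p / 2)"
proof -
  have "sqrt (x ^ p) = (x ^ p) powr (1 / 2)"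
    using assms by (intro powr_half_sqrt[symmetric]) simp
  also have "\<dots> = (x powr real p) powr (1 / 2)"
    using assms by (simp only: powr_realpow)
  finally show ?thesis by (simp only: powr_powr) simp
qed

lemma prod_normal_density:
  assumes "finite I" "0 < \<sigma>"
  shows "(\<Prod>i\<in>I. normal_density 0 (sqrt \<sigma>) (y i)) =
    (2 * pi * \<sigma>) powr (- (card I / 2)) * exp (- (\<Sum>i\<in>I. (y i)\<^sup>2) / (2 * \<sigma>))"
proof -
  have "(1 / sqrt (2 * pi * \<sigma>)) ^ card I = (2 * pi * \<sigma>) powr (- (card I / 2))"
    using assms(2) by (simp add: power_one_over real_sqrt_power[symmetric] sqrt_power_powr powr_minus_divide
        del: real_sqrt_power)
  then show ?thesis
    using assms unfolding normal_density_def prod.distrib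
    by (simp add: exp_sum[symmetric] sum_negf sum_divide_distrib)
qed

text \<open>Bayes' rule as a pointwise factorisation: prior times likelihood is evidence times
  posterior. Exponents of \<open>\<sigma>\<close> and of \<open>exp\<close> add up, and
  \<open>marginal_density\<close> collects the constants. For \<open>\<sigma> \<le> 0\<close> both
  sides vanish.\<close>

lemma ig_density_times_normal:
  assumes I: "finite I" and a: "0 < a" and b: "0 < b"
  shows "ig_density a b \<sigma> * (\<Prod>i\<in>I. normal_density 0 (sqrt \<sigma>) (y i)) =
    marginal_density a b (card I) (\<Sum>i\<in>I. (y i)\<^sup>2)
      * ig_density (a + card I / 2) (b + (\<Sum>i\<in>I. (y i)\<^sup>2) / 2) \<sigma>"
proof (cases "0 < \<sigma>")
  case True
  let ?q = "\<Sum>i\<in>I. (y i)\<^sup>2" and ?N = "real (card I) / 2"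
  have b': "0 < b + ?q / 2" using b by (intro add_pos_nonneg) (auto intro!: sum_nonneg)
  have e: "exp (- b / \<sigma>) * exp (- ?q / (2 * \<sigma>)) = exp (- (b + ?q / 2) / \<sigma>)"
    using True by (simp add: exp_add[symmetric] field_simps)
  have p: "\<sigma> powr (- (a + 1)) * (2 * pi * \<sigma>) powr (- ?N) =
      (2 * pi) powr (- ?N) * \<sigma> powr (- ((a + ?N) + 1))"
    using True by (simp add: powr_mult powr_add[symmetric] algebra_simps)
  have "ig_density a b \<sigma> * (\<Prod>i\<in>I. normal_density 0 (sqrt \<sigma>) (y i)) =
      b powr a / Gamma a * (\<sigma> powr (- (a + 1)) * (2 * pi * \<sigma>) powr (- ?N)) *
      (exp (- b / \<sigma>) * exp (- ?q / (2 * \<sigma>)))"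
    using True by (simp add: ig_density_def prod_normal_density[OF I True])
  also have "\<dots> = marginal_density a b (card I) ?q * ig_density (a + ?N) (b + ?q / 2) \<sigma>"
  proof -
    have "0 < Gamma (a + ?N)" using a by (intro Gamma_real_pos add_pos_nonneg) auto
    moreover have "(b + ?q / 2) powr (a + ?N) \<noteq> 0" using b' by simp
    ultimately have "Gamma (a + ?N) \<noteq> 0" "(b + ?q / 2) powr (a + ?N) \<noteq> 0" by auto
    then show ?thesis
      unfolding e p marginal_density_def ig_density_def using True by simp
  qed
  finally show ?thesis .
qed (simp add: ig_density_def)

lemma nn_integral_ig_density_normal:
  assumes I: "finite I" and a: "0 < a" and b: "0 < b"
  shows "(\<integral>\<^sup>+\<sigma>. ennreal (ig_density a b \<sigma>) * (\<Prod>i\<in>I. ennreal (normal_density 0 (sqrt \<sigma>) (y i))) \<partial>lborel) =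
    ennreal (marginal_density a b (card I) (\<Sum>i\<in>I. (y i)\<^sup>2))"
proof -
  let ?q = "\<Sum>i\<in>I. (y i)\<^sup>2" and ?N = "real (card I) / 2"
  have b': "0 < b + ?q / 2" using b by (intro add_pos_nonneg) (auto intro!: sum_nonneg)
  have "ennreal (ig_density a b \<sigma>) * (\<Prod>i\<in>I. ennreal (normal_density 0 (sqrt \<sigma>) (y i))) =
      ennreal (marginal_density a b (card I) ?q) * ennreal (ig_density (a + ?N) (b + ?q / 2) \<sigma>)" for \<sigma>
    using ig_density_times_normal[OF assms, of \<sigma> y] a
    by (simp add: prod_ennreal ennreal_mult[symmetric] ig_density_nonneg marginal_density_nonneg prod_nonneg)
  then show ?thesis
    using a b' by (simp add: nn_integral_cmult nn_integral_ig_density)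
qed

text \<open>With \<open>2 * a\<close> degrees of freedom and scale \<open>b / a\<close>, the
  products in the Student density simplify: \<open>2 * a * (b / a) = 2 * b\<close>. So the Student
  density in orthonormalised coordinates is the inverse gamma mixture of normal densities.\<close>

lemma student_density_eq_marginal:
  assumes a: "0 < a" and b: "0 < b" and q: "0 \<le> q"
  shows "Gamma ((2 * a + real p) / 2) / (Gamma ((2 * a) / 2) * sqrt ((pi * (2 * a) * (b / a)) ^ p))
      * (1 + q / (2 * b)) powr (- (2 * a + real p) / 2) = marginal_density a b p q"
proof -
  have 1: "sqrt ((pi * (2 * a) * (b / a)) ^ p) = (2 * pi) powr (p / 2) * b powr (p / 2)"
  proof -
    have "pi * (2 * a) * (b / a) = 2 * pi * b" using a by simp
    then show ?thesis using b by (simp add: sqrt_power_powr powr_mult del: real_sqrt_power)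
  qed
  have 2: "(1 + q / (2 * b)) powr (- (2 * a + real p) / 2) =
      b powr a * b powr (p / 2) / (b + q / 2) powr (a + p / 2)"
  proof -
    have "1 + q / (2 * b) = (b + q / 2) / b" using b by (simp add: field_simps)
    moreover have "- (2 * a + real p) / 2 = - (a + p / 2)" by (simp add: field_simps)
    ultimately have "(1 + q / (2 * b)) powr (- (2 * a + real p) / 2) = ((b + q / 2) / b) powr (- (a + p / 2))"
      by (simp only:)
    also have "\<dots> = 1 / ((b + q / 2) / b) powr (a + p / 2)"
      by (rule powr_minus_divide)
    also have "\<dots> = b powr (a + p / 2) / (b + q / 2) powr (a + p / 2)"
      using b q by (simp add: powr_divide)
    also have "b powr (a + p / 2) = b powr a * b powr (p / 2)"
      by (rule powr_add)
    finally show ?thesis .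
  qed
  have 3: "(2 * a + real p) / 2 = a + p / 2" "(2 * a) / 2 = a" by simp_all
  have 4: "(2 * pi) powr (- (real p / 2)) = 1 / (2 * pi) powr (p / 2)"
    by (rule powr_minus_divide)
  \<comment> \<open>Here \<open>B\<close> stands for \<open>b powr (p / 2)\<close>, once from the
    determinant in the normaliser and once from
    \<open>1 + q / (2 * b) = (b + q / 2) / b\<close>.\<close>
  have 5: "G / (H * (P * B)) * (c * B / D) = 1 / P * c / H * G / D" if "B \<noteq> 0" for G H P B c D :: real
    using that by (simp add: mult_ac)
  show ?thesis
    unfolding marginal_density_def 1 2 3 4 by (rule 5) (use b in simp)
qed

section \<open>Disintegration of joint laws, and products of densities\<close>

lemma has_cond_law_nn_integral:
  assumes M: "prob_space M" and law: "has_cond_law M N X L T \<kappa>"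
    and F: "F \<in> borel_measurable (L \<Otimes>\<^sub>M N)"
  shows "(\<integral>\<^sup>+\<omega>. F (T \<omega>, X \<omega>) \<partial>M) = (\<integral>\<^sup>+t. (\<integral>\<^sup>+x. F (t, x) \<partial>\<kappa> t) \<partial>distr M L T)"
proof -
  interpret M: prob_space M by fact
  have X [measurable]: "X \<in> M \<rightarrow>\<^sub>M N" and T [measurable]: "T \<in> M \<rightarrow>\<^sub>M L"
    and \<kappa> [measurable]: "\<kappa> \<in> L \<rightarrow>\<^sub>M prob_algebra N"
    and eq: "\<And>B C. B \<in> sets N \<Longrightarrow> C \<in> sets L \<Longrightarrow>
      emeasure M {\<omega> \<in> space M. X \<omega> \<in> B \<and> T \<omega> \<in> C} = (\<integral>\<^sup>+t\<in>C. emeasure (\<kappa> t) B \<partial>distr M L T)"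
    using law by (auto simp: has_cond_law_def)
  interpret D: prob_space "distr M L T" by (rule M.prob_space_distr) measurable
  \<comment> \<open>The kernel that keeps \<open>t\<close> and draws the second component from
    \<open>\<kappa> t\<close>; bound to the law of \<open>T\<close> it has to give the joint
    law.\<close>
  let ?k = "\<lambda>t. distr (\<kappa> t) (L \<Otimes>\<^sub>M N) (\<lambda>x. (t, x))"
  let ?E = "{a \<times> b |a b. a \<in> sets L \<and> b \<in> sets N}"
  have k: "?k \<in> distr M L T \<rightarrow>\<^sub>M subprob_algebra (L \<Otimes>\<^sub>M N)"
    by (intro measurable_prob_algebraD) measurable
  have sets\<kappa>: "sets (\<kappa> t) = sets N" if "t \<in> space L" for t
    using measurable_space[OF \<kappa> that] by (simp add: space_prob_algebra)
  have ne: "space L \<noteq> {}" using D.not_empty by simp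
  \<comment> \<open>The hypothesis is this equality on rectangles, an intersection-stable generator
    of the product, and the joint law is finite.\<close>
  have bind: "distr M (L \<Otimes>\<^sub>M N) (\<lambda>\<omega>. (T \<omega>, X \<omega>)) = distr M L T \<bind> ?k"
  proof (rule measure_eqI_generator_eq[OF Int_stable_pair_measure_generator[of L N], where A="\<lambda>_. space L \<times> space N"])
    show "?E \<subseteq> Pow (space L \<times> space N)"
      using sets.space_closed[of L] sets.space_closed[of N] by auto
    fix S assume "S \<in> ?E"
    then obtain C B where S: "S = C \<times> B" and C [measurable]: "C \<in> sets L" and B [measurable]: "B \<in> sets N"
      by auto
    have "emeasure (distr M (L \<Otimes>\<^sub>M N) (\<lambda>\<omega>. (T \<omega>, X \<omega>))) S = emeasure M {\<omega> \<in> space M. X \<omega> \<in> B \<and> T \<omega> \<in> C}"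
      unfolding S by (subst emeasure_distr) (auto intro!: arg_cong[where f="emeasure M"])
    also have "\<dots> = (\<integral>\<^sup>+t. emeasure (?k t) S \<partial>distr M L T)"
      unfolding eq[OF B C]
    proof (rule nn_integral_cong)
      fix t assume "t \<in> space (distr M L T)"
      then have t: "t \<in> space L" by simp
      have m: "(\<lambda>x. (t, x)) \<in> \<kappa> t \<rightarrow>\<^sub>M L \<Otimes>\<^sub>M N"
        using t by (subst measurable_cong_sets[OF sets\<kappa>[OF t] refl]) (rule measurable_Pair1')
      have "emeasure (?k t) S = emeasure (\<kappa> t) (if t \<in> C then B else {})"
        unfolding S using m sets.sets_into_space[OF B] sets_eq_imp_space_eq[OF sets\<kappa>[OF t]]
        by (subst emeasure_distr) (auto intro!: arg_cong[where f="emeasure (\<kappa> t)"])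
      then show "emeasure (\<kappa> t) B * indicator C t = emeasure (?k t) S" by simp
    qed
    also have "\<dots> = emeasure (distr M L T \<bind> ?k) S"
      unfolding S by (rule emeasure_bind[OF _ k, symmetric]) (use ne in auto)
    finally show "emeasure (distr M (L \<Otimes>\<^sub>M N) (\<lambda>\<omega>. (T \<omega>, X \<omega>))) S = emeasure (distr M L T \<bind> ?k) S" .
  next
    have "sets (distr M L T \<bind> ?k) = sets (L \<Otimes>\<^sub>M N)"
      using ne by (intro sets_bind) auto
    then show "sets (distr M L T \<bind> ?k) = sigma_sets (space L \<times> space N) ?E"
      by (simp add: sets_pair_measure)
    show "emeasure (distr M (L \<Otimes>\<^sub>M N) (\<lambda>\<omega>. (T \<omega>, X \<omega>))) (space L \<times> space N) \<noteq> \<infinity>"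
      using M.prob_space_distr[of "\<lambda>\<omega>. (T \<omega>, X \<omega>)" "L \<Otimes>\<^sub>M N"]
      by (simp add: prob_space.emeasure_space_1[unfolded space_distr space_pair_measure, of "distr M (L \<Otimes>\<^sub>M N) (\<lambda>\<omega>. (T \<omega>, X \<omega>))"] space_pair_measure finite_measure.emeasure_finite prob_space.finite_measure)
  qed (auto simp: sets_pair_measure)
  have "(\<integral>\<^sup>+\<omega>. F (T \<omega>, X \<omega>) \<partial>M) = (\<integral>\<^sup>+z. F z \<partial>distr M (L \<Otimes>\<^sub>M N) (\<lambda>\<omega>. (T \<omega>, X \<omega>)))"
    using F by (subst nn_integral_distr) auto
  also have "\<dots> = (\<integral>\<^sup>+t. (\<integral>\<^sup>+z. F z \<partial>?k t) \<partial>distr M L T)"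
    unfolding bind by (rule nn_integral_bind[OF F k])
  also have "\<dots> = (\<integral>\<^sup>+t. (\<integral>\<^sup>+x. F (t, x) \<partial>\<kappa> t) \<partial>distr M L T)"
  proof (rule nn_integral_cong)
    fix t assume "t \<in> space (distr M L T)"
    then have t: "t \<in> space L" by simp
    show "(\<integral>\<^sup>+z. F z \<partial>?k t) = (\<integral>\<^sup>+x. F (t, x) \<partial>\<kappa> t)"
      using t F by (subst nn_integral_distr)
        (auto simp: measurable_cong_sets[OF sets\<kappa>[OF t] refl] measurable_Pair1')
  qed
  finally show ?thesis .
qed

text \<open>On boxes both sides are products of one-dimensional integrals. Sigma-finiteness of the
  weighted factors is what lets boxes determine their product.\<close>

lemma PiM_density:
  assumes "product_sigma_finite M" and I: "finite I"
    and f [measurable]: "\<And>i. f i \<in> borel_measurable (M i)"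
    and fin: "\<And>i. sigma_finite_measure (density (M i) (f i))"
  shows "Pi\<^sub>M I (\<lambda>i. density (M i) (f i)) = density (Pi\<^sub>M I M) (\<lambda>y. \<Prod>i\<in>I. f i (y i))"
proof -
  interpret product_sigma_finite M by fact
  interpret d: product_sigma_finite "\<lambda>i. density (M i) (f i)"
    by (simp add: product_sigma_finite_def fin)
  show ?thesis
  proof (rule d.PiM_eqI[OF I, symmetric])
    have "sets (Pi\<^sub>M I (\<lambda>i. density (M i) (f i))) = sets (Pi\<^sub>M I M)"
      by (intro sets_PiM_cong) auto
    then show "sets (density (Pi\<^sub>M I M) (\<lambda>y. \<Prod>i\<in>I. f i (y i))) = sets (Pi\<^sub>M I (\<lambda>i. density (M i) (f i)))"
      by simp
    fix A assume A: "\<And>i. i \<in> I \<Longrightarrow> A i \<in> sets (density (M i) (f i))"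
    then have A' [measurable]: "A i \<in> sets (M i)" if "i \<in> I" for i using that by simp
    have PA: "Pi\<^sub>E I A \<in> sets (Pi\<^sub>M I M)"
      using A I by (intro sets_PiM_I_finite) auto
    have "emeasure (density (Pi\<^sub>M I M) (\<lambda>y. \<Prod>i\<in>I. f i (y i))) (Pi\<^sub>E I A) =
        (\<integral>\<^sup>+y. (\<Prod>i\<in>I. f i (y i)) * indicator (Pi\<^sub>E I A) y \<partial>Pi\<^sub>M I M)"
      using PA by (subst emeasure_density) auto
    also have "\<dots> = (\<integral>\<^sup>+y. (\<Prod>i\<in>I. f i (y i) * indicator (A i) (y i)) \<partial>Pi\<^sub>M I M)"
    proof (rule nn_integral_cong)
      fix y assume "y \<in> space (Pi\<^sub>M I M)"
      then have "y \<in> Pi\<^sub>E I A \<longleftrightarrow> (\<forall>i\<in>I. y i \<in> A i)"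
        by (auto simp: space_PiM PiE_iff)
      then have "indicator (Pi\<^sub>E I A) y = (\<Prod>i\<in>I. indicator (A i) (y i) :: ennreal)"
        using I by (auto simp: indicator_def)
      then show "(\<Prod>i\<in>I. f i (y i)) * indicator (Pi\<^sub>E I A) y = (\<Prod>i\<in>I. f i (y i) * indicator (A i) (y i))"
        by (simp add: prod.distrib)
    qed
    also have "\<dots> = (\<Prod>i\<in>I. \<integral>\<^sup>+t. f i t * indicator (A i) t \<partial>M i)"
      using I A' by (subst product_nn_integral_prod) auto
    also have "\<dots> = (\<Prod>i\<in>I. emeasure (density (M i) (f i)) (A i))"
      using A' by (intro prod.cong) (auto simp: emeasure_density)
    finally show "emeasure (density (Pi\<^sub>M I M) (\<lambda>y. \<Prod>i\<in>I. f i (y i))) (Pi\<^sub>E I A) =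
      (\<Prod>i\<in>I. emeasure (density (M i) (f i)) (A i))" .
  qed
qed

section \<open>Gaussian and Student laws in coordinates\<close>

lemma inner_transpose_mult: "v \<bullet> (B *v w) = (transpose B *v v) \<bullet> w"
  for B :: "real ^ 'n ^ 'm"
  by (simp add: dot_lmul_matrix transpose_matrix_vector)

lemma matrix_mult_transpose_columns:
  fixes L :: "real ^ 'm ^ 'n"
  shows "(L ** transpose L) *v w = (\<Sum>j\<in>UNIV. (w \<bullet> column j L) *\<^sub>R column j L)"
  by (simp add: matrix_matrix_mult_def transpose_def matrix_vector_mult_def vec_eq_iff column_def
      inner_vec_def sum_distrib_left sum_distrib_right sum.swap[of _ "UNIV::'m set"] mult_ac)

lemma norm_transpose_mult:
  fixes L :: "real ^ 'm ^ 'n"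
  shows "(transpose L *v w) \<bullet> (transpose L *v w) = w \<bullet> ((L ** transpose L) *v w)"
  by (simp add: inner_transpose_mult matrix_vector_mul_assoc[symmetric])

lemma nn_integral_lborel_eq_leb_Basis:
  fixes f :: "'a::euclidean_space \<Rightarrow> ennreal"
  assumes "f \<in> borel_measurable borel"
  shows "(\<integral>\<^sup>+x. f x \<partial>lborel) = (\<integral>\<^sup>+y. f (lincomb Basis (\<lambda>b. b) y) \<partial>leb Basis)"
  using assms unfolding lincomb_def
  by (subst lborel_eq, subst nn_integral_distr) auto

lemma prod_std_normal_density_vec:
  fixes z :: "real ^ 'n"
  shows "(\<Prod>i\<in>UNIV. std_normal_density (z $ i)) = (1 / sqrt (2 * pi)) ^ CARD('n) * exp (- (z \<bullet> z) / 2)"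
  unfolding std_normal_density_def prod.distrib
  by (simp add: exp_sum[symmetric] sum_negf sum_divide_distrib inner_vec_def power2_eq_square)

text \<open>The frame \<open>L\<^sup>-\<^sup>1 B\<close> is orthonormal for every \<open>L\<close> with \<open>L L\<^sup>T = B B\<^sup>T\<close>, so that the
  choice of \<open>L\<close> is immaterial.\<close>

lemma nn_integral_gaussian:
  fixes B :: "'i \<Rightarrow> real ^ 'n" and \<Sigma> :: "real ^ 'n ^ 'n"
  assumes I: "finite I" and card: "card I = CARD('n)"
    and nondeg: "\<And>w. (\<And>i. i \<in> I \<Longrightarrow> w \<bullet> B i = 0) \<Longrightarrow> w = 0"
    and \<Sigma>: "\<And>w. \<Sigma> *v w = lincomb I B (\<lambda>i. w \<bullet> B i)"
    and f [measurable]: "f \<in> borel_measurable borel"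
  shows "(\<integral>\<^sup>+x. f x \<partial>gaussian \<mu> \<Sigma>) =
    (\<integral>\<^sup>+y. ennreal (\<Prod>i\<in>I. std_normal_density (y i)) * f (\<mu> + lincomb I B y) \<partial>leb I)"
proof -
  define L where "L = (SOME L :: real ^ 'n ^ 'n. L ** transpose L = \<Sigma>)"
  \<comment> \<open>An \<open>L\<close> with \<open>L ** transpose L = \<Sigma>\<close> must be
    exhibited before \<open>SOME\<close> can be used. The vectors \<open>B i\<close>, arranged as
    columns by \<open>h\<close>, provide one.\<close>
  obtain h where h: "bij_betw h (UNIV :: 'n set) I"
    using finite_same_card_bij[OF finite I] card by auto
  have "(\<chi> i j. B (h j) $ i) ** transpose (\<chi> i j. B (h j) $ i) = \<Sigma>"
  proof (rule matrix_eq[THEN iffD2], rule allI)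
    fix w
    have "column j (\<chi> i j. B (h j) $ i) = B (h j)" for j by (simp add: column_def vec_eq_iff)
    then have "((\<chi> i j. B (h j) $ i) ** transpose (\<chi> i j. B (h j) $ i)) *v w =
        (\<Sum>j\<in>UNIV. (w \<bullet> B (h j)) *\<^sub>R B (h j))"
      by (simp add: matrix_mult_transpose_columns)
    also have "\<dots> = (\<Sum>i\<in>I. (w \<bullet> B i) *\<^sub>R B i)"
      by (rule sum.reindex_bij_betw[OF h])
    finally show "((\<chi> i j. B (h j) $ i) ** transpose (\<chi> i j. B (h j) $ i)) *v w = \<Sigma> *v w"
      by (simp add: \<Sigma> lincomb_def)
  qed
  then have LL: "L ** transpose L = \<Sigma>" unfolding L_def by (rule someI)
  have form: "(transpose L *v w) \<bullet> (transpose L *v w) = (\<Sum>i\<in>I. (w \<bullet> B i)\<^sup>2)" for w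
    unfolding norm_transpose_mult LL \<Sigma> by (simp add: lincomb_def inner_sum_right power2_eq_square)
  \<comment> \<open>The squared norm of \<open>transpose L *v w\<close> is the quadratic form of the
    frame, which is nondegenerate. So the chosen \<open>L\<close> is invertible, with inverse
    \<open>T\<close> below.\<close>
  have "w = 0" if "transpose L *v w = 0" for w
  proof (rule nondeg)
    fix i assume "i \<in> I"
    then show "w \<bullet> B i = 0"
      using form[of w] that sum_nonneg_eq_0_iff[OF I, of "\<lambda>i. (w \<bullet> B i)\<^sup>2"] by auto
  qed
  then obtain T' where "T' ** transpose L = mat 1"
    using matrix_left_invertible_ker[of "transpose L"] by blast
  then have LT: "L ** transpose T' = mat 1"
    by (metis matrix_transpose_mul transpose_mat transpose_transpose)
  define T where "T = transpose T'"
  have LT: "L ** T = mat 1" using LT by (simp add: T_def)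
  have "T ** L = mat 1" using LT matrix_left_right_inverse by blast
  then have TT: "transpose L ** transpose T = mat 1"
    by (metis matrix_transpose_mul transpose_mat)
  let ?B = "\<lambda>i. T *v B i"
  \<comment> \<open>At \<open>transpose T *v w\<close> the form of \<open>B\<close> is the squared
    norm of \<open>transpose L *v (transpose T *v w) = w\<close>, the form of the standard
    basis.\<close>
  have form': "(\<Sum>i\<in>I. (w \<bullet> ?B i)\<^sup>2) = (\<Sum>b\<in>Basis. (w \<bullet> b)\<^sup>2)" for w
  proof -
    have "transpose L *v (transpose T *v w) = w"
      by (simp only: matrix_vector_mul_assoc TT matrix_vector_mul_lid)
    then have "(\<Sum>i\<in>I. (w \<bullet> ?B i)\<^sup>2) = w \<bullet> w"
      using form[of "transpose T *v w"] by (simp only: inner_transpose_mult)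
    also have "\<dots> = (\<Sum>b\<in>Basis. (b \<bullet> w)\<^sup>2)" by (rule inner_eq_sum_Basis)
    finally show ?thesis by (simp only: inner_commute)
  qed
  have on: "orthonormal_on I ?B"
    using orthonormal_on_same_form[OF I finite_Basis _ orthonormal_on_Basis form'] card by simp
  have span: "span (?B ` I) = span ((\<lambda>b. b) ` Basis)"
    by (rule orthonormal_same_form_span[OF I finite_Basis orthonormal_on_Basis on form'])
  let ?g = "\<lambda>z. ennreal ((1 / sqrt (2 * pi)) ^ CARD('n) * exp (- (z \<bullet> z) / 2)) * f (\<mu> + L *v z)"
  have Lb [measurable]: "(*v) L \<in> borel_measurable borel"
    by (intro borel_measurable_continuous_onI continuous_intros)
  have "(\<integral>\<^sup>+x. f x \<partial>gaussian \<mu> \<Sigma>) = (\<integral>\<^sup>+z. f (\<mu> + L *v z) \<partial>std_gaussian)"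
    unfolding gaussian_def Let_def L_def[symmetric]
    by (subst nn_integral_distr) (auto simp: std_gaussian_def)
  also have "\<dots> = (\<integral>\<^sup>+z. ?g z \<partial>lborel)"
    unfolding std_gaussian_def by (subst nn_integral_density) (auto simp: prod_std_normal_density_vec)
  also have "\<dots> = (\<integral>\<^sup>+y. ?g (lincomb Basis (\<lambda>b. b) y) \<partial>leb Basis)"
    by (rule nn_integral_lborel_eq_leb_Basis) measurable
  also have "\<dots> = (\<integral>\<^sup>+y. ?g (lincomb I ?B y) \<partial>leb I)"
    by (rule nn_integral_orthonormal_eq[OF I finite_Basis _ on orthonormal_on_Basis span, symmetric])
      (auto simp: card)
  also have "\<dots> = (\<integral>\<^sup>+y. ennreal (\<Prod>i\<in>I. std_normal_density (y i)) * f (\<mu> + lincomb I B y) \<partial>leb I)"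
  proof (rule nn_integral_cong)
    fix y
    have "L *v lincomb I ?B y = lincomb I (\<lambda>i. L *v ?B i) y"
      by (rule linear_lincomb) simp
    also have "(\<lambda>i. L *v ?B i) = B" by (simp add: matrix_vector_mul_assoc LT)
    finally show "?g (lincomb I ?B y) =
      ennreal (\<Prod>i\<in>I. std_normal_density (y i)) * f (\<mu> + lincomb I B y)"
      by (simp add: prod_std_normal_density[OF I on] card)
  qed
  finally show ?thesis .
qed

lemma sqrt_prod_lessThan: "sqrt (\<Prod>i<p. f i) = (\<Prod>i<p. sqrt (f i))" for p :: nat
  by (induction p) (simp_all add: real_sqrt_mult)

lemma normal_density_scale: "0 < \<tau> \<Longrightarrow> \<tau> * normal_density 0 \<tau> (\<tau> * t) = std_normal_density t"
  by (simp add: normal_density_def real_sqrt_mult field_simps)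

text \<open>The previous formula for the family \<open>\<tau> i *\<^sub>R B i\<close>, followed by
  rescaling. Moving the scales from the vectors into the densities lets the random variance act on
  the density only, while the point stays the same function of the coordinates.\<close>

lemma nn_integral_gaussian_scaled:
  fixes B :: "'i \<Rightarrow> real ^ 'n" and \<Sigma> :: "real ^ 'n ^ 'n"
  assumes I: "finite I" and card: "card I = CARD('n)" and \<tau>: "\<And>i. i \<in> I \<Longrightarrow> 0 < \<tau> i"
    and nondeg: "\<And>w. (\<And>i. i \<in> I \<Longrightarrow> w \<bullet> B i = 0) \<Longrightarrow> w = 0"
    and \<Sigma>: "\<And>w. \<Sigma> *v w = lincomb I B (\<lambda>i. (\<tau> i)\<^sup>2 * (w \<bullet> B i))"
    and f [measurable]: "f \<in> borel_measurable borel"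
  shows "(\<integral>\<^sup>+x. f x \<partial>gaussian \<mu> \<Sigma>) =
    (\<integral>\<^sup>+y. ennreal (\<Prod>i\<in>I. normal_density 0 (\<tau> i) (y i)) * f (\<mu> + lincomb I B y) \<partial>leb I)"
proof -
  let ?C = "\<lambda>i. \<tau> i *\<^sub>R B i"
  have [measurable]: "(\<lambda>y. ennreal (\<Prod>i\<in>I. normal_density 0 (\<tau> i) (y i)) * f (\<mu> + lincomb I B y))
      \<in> borel_measurable (leb I)"
    by measurable
  have lc: "lincomb I ?C y = lincomb I B (\<lambda>i. \<tau> i * y i)" for y
    by (simp add: lincomb_def mult.commute)
  have [measurable]: "(\<lambda>y. lincomb I B (\<lambda>i. \<tau> i * y i)) \<in> borel_measurable (leb I)"
    unfolding lc[symmetric] by measurable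
  have "(\<integral>\<^sup>+x. f x \<partial>gaussian \<mu> \<Sigma>) =
      (\<integral>\<^sup>+y. ennreal (\<Prod>i\<in>I. std_normal_density (y i)) * f (\<mu> + lincomb I ?C y) \<partial>leb I)"
  proof (rule nn_integral_gaussian[OF I card])
    show "w = 0" if "\<And>i. i \<in> I \<Longrightarrow> w \<bullet> ?C i = 0" for w
      using that \<tau> by (intro nondeg) force
    show "\<Sigma> *v w = lincomb I ?C (\<lambda>i. w \<bullet> ?C i)" for w
      unfolding lc \<Sigma> by (intro lincomb_cong) (simp add: power2_eq_square)
  qed measurable
  also have "\<dots> = (\<integral>\<^sup>+y. (\<Prod>i\<in>I. ennreal \<bar>\<tau> i\<bar>) * (ennreal (\<Prod>i\<in>I. normal_density 0 (\<tau> i) (\<tau> i * y i))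
      * f (\<mu> + lincomb I B (\<lambda>i. \<tau> i * y i))) \<partial>leb I)"
  proof (rule nn_integral_cong)
    fix y
    have "(\<Prod>i\<in>I. ennreal \<bar>\<tau> i\<bar>) = ennreal (\<Prod>i\<in>I. \<tau> i)"
      using \<tau> by (simp add: prod_ennreal[symmetric] less_imp_le cong: prod.cong)
    then have "(\<Prod>i\<in>I. ennreal \<bar>\<tau> i\<bar>) * ennreal (\<Prod>i\<in>I. normal_density 0 (\<tau> i) (\<tau> i * y i)) =
        ennreal (\<Prod>i\<in>I. \<tau> i * normal_density 0 (\<tau> i) (\<tau> i * y i))"
      using \<tau> by (simp add: prod.distrib ennreal_mult prod_nonneg less_imp_le)
    also have "\<dots> = ennreal (\<Prod>i\<in>I. std_normal_density (y i))"
      using \<tau> by (intro arg_cong[where f=ennreal] prod.cong) (auto simp: normal_density_scale)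
    finally show "ennreal (\<Prod>i\<in>I. std_normal_density (y i)) * f (\<mu> + lincomb I ?C y) =
      (\<Prod>i\<in>I. ennreal \<bar>\<tau> i\<bar>) * (ennreal (\<Prod>i\<in>I. normal_density 0 (\<tau> i) (\<tau> i * y i))
      * f (\<mu> + lincomb I B (\<lambda>i. \<tau> i * y i)))"
      by (simp add: lc mult.assoc[symmetric])
  qed
  also have "\<dots> = (\<Prod>i\<in>I. ennreal \<bar>\<tau> i\<bar>) * (\<integral>\<^sup>+y. ennreal (\<Prod>i\<in>I. normal_density 0 (\<tau> i) (\<tau> i * y i))
      * f (\<mu> + lincomb I B (\<lambda>i. \<tau> i * y i)) \<partial>leb I)"
    by (rule nn_integral_cmult) measurable
  also have "\<dots> = (\<integral>\<^sup>+y. ennreal (\<Prod>i\<in>I. normal_density 0 (\<tau> i) (y i)) * f (\<mu> + lincomb I B y) \<partial>leb I)"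
    using \<tau> nn_integral_leb_affine[OF I, of \<tau>
        "\<lambda>y. ennreal (\<Prod>i\<in>I. normal_density 0 (\<tau> i) (y i)) * f (\<mu> + lincomb I B y)" "\<lambda>_. 0"]
    by (force cong: prod.cong)
  finally show ?thesis .
qed

lemma orthonormal_on_dim_span:
  assumes "finite I" "orthonormal_on I B"
  shows "dim (span (B ` I)) = card I"
  using orthonormal_on_independent[OF assms] by (simp add: dim_eq_card_independent card_image)

text \<open>Any two orthonormal frames of one subspace give the same integral, so the basis picked
  by \<open>SOME\<close> can be exchanged for \<open>u\<close>.\<close>

lemma nn_integral_affine_lebesgue:
  fixes u :: "nat \<Rightarrow> real ^ 'n"
  assumes u: "orthonormal_on {..<p} u" and f [measurable]: "f \<in> borel_measurable borel"
  shows "(\<integral>\<^sup>+x. f x \<partial>affine_lebesgue \<mu> (span (u ` {..<p}))) =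
    (\<integral>\<^sup>+y. f (\<mu> + lincomb {..<p} u y) \<partial>leb {..<p})"
proof -
  have dim: "dim (span (u ` {..<p})) = p"
    using orthonormal_on_dim_span[OF _ u] by simp
  define U where "U = (SOME U. orthonormal_cols p U \<and> span (U ` {..<p}) = span (u ` {..<p}))"
  have "orthonormal_cols p U \<and> span (U ` {..<p}) = span (u ` {..<p})"
    unfolding U_def by (rule someI[of _ u]) (use u in \<open>simp add: orthonormal_cols_iff\<close>)
  then have U: "orthonormal_on {..<p} U" "span (U ` {..<p}) = span (u ` {..<p})"
    by (auto simp: orthonormal_cols_iff)
  have "(\<integral>\<^sup>+x. f x \<partial>affine_lebesgue \<mu> (span (u ` {..<p}))) =
      (\<integral>\<^sup>+y. f (\<mu> + lincomb {..<p} U y) \<partial>leb {..<p})"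
    unfolding affine_lebesgue_def dim Let_def U_def[symmetric] lincomb_def[symmetric]
    by (subst nn_integral_distr) auto
  also have "\<dots> = (\<integral>\<^sup>+y. f (\<mu> + lincomb {..<p} u y) \<partial>leb {..<p})"
    using nn_integral_orthonormal_eq[OF _ _ refl U(1) u U(2), of "\<lambda>v. f (\<mu> + v)"] by simp
  finally show ?thesis .
qed

lemma sets_affine_lebesgue [simp, measurable_cong]: "sets (affine_lebesgue \<mu> S) = sets borel"
  by (simp add: affine_lebesgue_def Let_def)

text \<open>The columns of \<open>Y\<close> and the rescaled eigenvectors of \<open>Y Y\<^sup>T\<close> both become orthonormal bases
  of the same subspace under \<open>A\<^sup>1\<^sup>/\<^sup>2\<close>.\<close>

lemma student_eq_distr:
  fixes A :: "real ^ 'n ^ 'n" and Y :: "nat \<Rightarrow> real ^ 'n"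
  assumes A: "sym_pos_def A"
    and Y: "\<And>i j. i < p \<Longrightarrow> j < p \<Longrightarrow> Y i \<bullet> (A *v Y j) = (if i = j then 1 else 0)"
    and c: "0 < c" and \<nu>: "0 < \<nu>"
  shows "student \<nu> \<mu> (c *\<^sub>R cols_diag_cols p Y (\<lambda>_. 1)) =
    distr (density (leb {..<p}) (\<lambda>y. ennreal (Gamma ((\<nu> + real p) / 2) / (Gamma (\<nu> / 2) * sqrt ((pi * \<nu> * c) ^ p))
      * (1 + (\<Sum>l<p. (y l)\<^sup>2) / (\<nu> * c)) powr (- (\<nu> + real p) / 2))))
    borel (\<lambda>y. \<mu> + lincomb {..<p} Y y)"
proof -
  define S where "S = c *\<^sub>R cols_diag_cols p Y (\<lambda>_. 1)"
  define R where "R = matrix_sqrt A"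
  let ?I = "{..<p}"
  let ?E = "\<lambda>l. R *v Y l"
  have S_mult: "S *v w = lincomb ?I Y (\<lambda>l. c * (w \<bullet> Y l))" for w
    by (simp add: S_def cols_diag_cols_scaleR cols_diag_cols_mult)
  have R_inner: "(R *v v) \<bullet> (R *v w) = v \<bullet> (A *v w)" for v w
    unfolding R_def by (rule matrix_sqrt_inner[OF A])
  have R_pd: "sym_pos_def R" unfolding R_def by (rule matrix_sqrt_correct(1)[OF A])
  have R_sym: "v \<bullet> (R *v w) = (R *v v) \<bullet> w" for v w
    using symmetric_matrix_inner[OF sym_pos_def_sym[OF R_pd], of v w] by simp
  have A_sym: "v \<bullet> (A *v w) = (A *v v) \<bullet> w" for v w
    using symmetric_matrix_inner[OF sym_pos_def_sym[OF A], of v w] by simp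
  obtain R' where R': "R' ** R = mat 1"
    using matrix_left_invertible_ker[of R] sym_pos_def_inj[OF R_pd] by blast
  have E: "orthonormal_on ?I ?E"
    by (auto simp: orthonormal_on_def R_inner Y)
  have RY: "R *v lincomb ?I Y y = lincomb ?I ?E y" for y
    by (rule linear_lincomb) simp
  have AY: "(A *v lincomb ?I Y y) \<bullet> Y l = y l" if "l < p" for y l
    using orthonormal_lincomb_inner[OF _ E, of l y] that
    by (simp add: RY[symmetric] R_inner A_sym)
  have AYY: "(A *v lincomb ?I Y y) \<bullet> lincomb ?I Y y = (\<Sum>l<p. (y l)\<^sup>2)" for y
    using orthonormal_inner_lincomb[OF _ E, of y]
    by (simp add: RY[symmetric] R_inner A_sym)
  \<comment> \<open>On the span of \<open>Y\<close>, multiplication by \<open>A\<close> inverts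
    \<open>Y Y\<^sup>T\<close>, by \<open>Y\<^sup>T A Y = I\<close>. This gives the range of
    \<open>S\<close> and the quadratic form of its pseudoinverse.\<close>
  have SA: "S *v (A *v lincomb ?I Y y) = c *\<^sub>R lincomb ?I Y y" for y
  proof -
    have "S *v (A *v lincomb ?I Y y) = lincomb ?I Y (\<lambda>l. c * y l)"
      unfolding S_mult by (rule lincomb_cong) (simp add: AY)
    then show ?thesis by (simp add: lincomb_def scaleR_sum_right)
  qed
  have range: "range ((*v) S) = span (Y ` ?I)"
  proof (intro equalityI subsetI)
    fix v assume "v \<in> span (Y ` ?I)"
    then obtain y where y: "v = lincomb ?I Y y" using span_image_lincomb[of ?I] by blast
    have "v = S *v ((1 / c) *\<^sub>R (A *v v))"
      using c unfolding y matrix_vector_mult_scaleR SA by simp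
    then show "v \<in> range ((*v) S)" by blast
  qed (auto simp: S_mult lincomb_in_span)
  have rank: "rank S = p"
  proof -
    have inj: "inj ((*v) R)"
      using sym_pos_def_rank[OF R_pd] full_rank_injective by blast
    have "dim (?E ` ?I) = dim (Y ` ?I)"
      using dim_image_eq[of "(*v) R" "Y ` ?I"] inj by (simp add: image_image inj_on_subset)
    then show ?thesis
      using orthonormal_on_dim_span[OF _ E] by (simp add: rank_dim_range range)
  qed
  have "\<exists>U d. spectral_decomposition S U d"
  proof (rule spectral_decomposition_exists)
    show "transpose S = S" unfolding S_def cols_diag_cols_scaleR by simp
    show "0 \<le> v \<bullet> (S *v v)" for v
      unfolding S_def cols_diag_cols_scaleR inner_cols_diag_cols
      using c by (intro sum_nonneg) (simp add: mult.assoc)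
  qed
  then have ex: "\<exists>d U. spectral_decomposition S U d" by blast
  define d where "d = (SOME d. \<exists>U. spectral_decomposition S U d)"
  obtain u where sp: "spectral_decomposition S u d"
    using someI_ex[OF ex] unfolding d_def by blast
  have u: "orthonormal_on ?I u" and d: "\<And>i. i < p \<Longrightarrow> 0 < d i" and Sd: "S = cols_diag_cols p u d"
    using sp unfolding spectral_decomposition_def rank orthonormal_cols_iff by auto
  have span_u: "span (u ` ?I) = range ((*v) S)"
    using spectral_decomposition_span[OF sp] by (simp add: rank)
  \<comment> \<open>With these lengths the vectors \<open>a i *\<^sub>R u i\<close> have the
    quadratic form of \<open>S / c = Y Y\<^sup>T\<close>, the same as the columns of
    \<open>Y\<close>.\<close>
  define a where "a i = sqrt (d i / c)" for i
  have a: "0 < a i" if "i < p" for i using d[OF that] c by (simp add: a_def)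
  let ?C = "\<lambda>i. a i *\<^sub>R u i"
  let ?F = "\<lambda>i. R *v ?C i"
  have form: "(\<Sum>i<p. (w \<bullet> ?F i)\<^sup>2) = (\<Sum>l<p. (w \<bullet> ?E l)\<^sup>2)" for w
  proof -
    let ?v = "R *v w"
    have "(\<Sum>i<p. (w \<bullet> ?F i)\<^sup>2) = (\<Sum>i<p. (d i / c) * (?v \<bullet> u i)\<^sup>2)"
      using c d by (intro sum.cong) (auto simp: R_sym power_mult_distrib a_def less_imp_le)
    also have "\<dots> = (1 / c) * (?v \<bullet> (S *v ?v))"
      by (subst Sd) (simp add: inner_cols_diag_cols sum_distrib_left power2_eq_square mult_ac)
    also have "\<dots> = (\<Sum>l<p. (?v \<bullet> Y l)\<^sup>2)"
      unfolding S_mult using c by (simp add: lincomb_def inner_sum_right sum_distrib_left power2_eq_square)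
    finally show ?thesis by (simp add: R_sym)
  qed
  have F: "orthonormal_on ?I ?F"
    by (rule orthonormal_on_same_form[OF _ _ refl E form]) auto
  have span_F: "span (?F ` ?I) = span (?E ` ?I)"
    by (rule orthonormal_same_form_span[OF _ _ E F form]) auto
  \<comment> \<open>Orthonormality holds only after applying \<open>R\<close>. The inverse
    \<open>R'\<close> inside the integrand brings the comparison back to the original
    vectors.\<close>
  have CY: "(\<integral>\<^sup>+y. f (\<mu> + lincomb ?I ?C y) \<partial>leb ?I) = (\<integral>\<^sup>+y. f (\<mu> + lincomb ?I Y y) \<partial>leb ?I)"
    if f [measurable]: "f \<in> borel_measurable borel" for f :: "real ^ 'n \<Rightarrow> ennreal"
  proof -
    have [measurable]: "(*v) R' \<in> borel_measurable borel"
      by (intro borel_measurable_continuous_onI continuous_intros)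
    have R'_lc: "R' *v lincomb ?I (\<lambda>i. R *v D i) y = lincomb ?I D y" for D :: "nat \<Rightarrow> real ^ 'n" and y
      using linear_lincomb[of "(*v) R'" ?I "\<lambda>i. R *v D i" y]
      by (simp add: matrix_vector_mul_assoc R')
    have "(\<integral>\<^sup>+y. f (\<mu> + R' *v lincomb ?I ?F y) \<partial>leb ?I) = (\<integral>\<^sup>+y. f (\<mu> + R' *v lincomb ?I ?E y) \<partial>leb ?I)"
      by (rule nn_integral_orthonormal_eq[OF _ _ refl F E span_F]) auto
    then show ?thesis unfolding R'_lc .
  qed
  have aff: "(\<integral>\<^sup>+x. f x \<partial>affine_lebesgue \<mu> (range ((*v) S))) =
      (\<Prod>i<p. ennreal (a i)) * (\<integral>\<^sup>+y. f (\<mu> + lincomb ?I Y y) \<partial>leb ?I)"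
    if f [measurable]: "f \<in> borel_measurable borel" for f
  proof -
    have "(\<integral>\<^sup>+x. f x \<partial>affine_lebesgue \<mu> (range ((*v) S))) = (\<integral>\<^sup>+y. f (\<mu> + lincomb ?I u y) \<partial>leb ?I)"
      unfolding span_u[symmetric] by (rule nn_integral_affine_lebesgue[OF u f])
    also have "\<dots> = (\<Prod>i<p. ennreal \<bar>a i\<bar>) * (\<integral>\<^sup>+y. f (\<mu> + lincomb ?I u (\<lambda>i. a i * y i)) \<partial>leb ?I)"
      using nn_integral_leb_affine[of ?I a "\<lambda>y. f (\<mu> + lincomb ?I u y)" "\<lambda>_. 0"] a by force
    also have "(\<Prod>i<p. ennreal \<bar>a i\<bar>) = (\<Prod>i<p. ennreal (a i))"
      using a by (intro prod.cong) (auto simp: less_imp_le)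
    also have "(\<integral>\<^sup>+y. f (\<mu> + lincomb ?I u (\<lambda>i. a i * y i)) \<partial>leb ?I) = (\<integral>\<^sup>+y. f (\<mu> + lincomb ?I ?C y) \<partial>leb ?I)"
      by (simp add: lincomb_def mult.commute)
    finally show ?thesis using CY[OF f] by simp
  qed
  have pinv: "lincomb ?I Y y \<bullet> (pinv S *v lincomb ?I Y y) = (\<Sum>l<p. (y l)\<^sup>2) / c" for y
  proof -
    let ?v = "lincomb ?I Y y"
    define w where "w = (1 / c) *\<^sub>R (A *v ?v)"
    have v: "?v = S *v w"
      using c unfolding w_def matrix_vector_mult_scaleR SA by simp
    have S_sym: "(S *v x) \<bullet> z = x \<bullet> (S *v z)" for x z
      by (rule symmetric_matrix_inner) (simp add: S_def cols_diag_cols_scaleR)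
    have "?v \<bullet> (pinv S *v ?v) = w \<bullet> ((S ** pinv S ** S) *v w)"
      unfolding v by (simp add: S_sym matrix_vector_mul_assoc matrix_mul_assoc)
    also have "\<dots> = w \<bullet> ?v" unfolding pinv_spectral[OF sp] v ..
    finally show ?thesis by (simp add: w_def AYY)
  qed
  let ?k = "Gamma ((\<nu> + real p) / 2) / (Gamma (\<nu> / 2) * sqrt ((pi * \<nu>) ^ p * (\<Prod>i<p. d i)))"
  let ?dens = "\<lambda>x. ennreal (?k * (1 + 1 / \<nu> * ((x - \<mu>) \<bullet> (pinv S *v (x - \<mu>)))) powr (- (\<nu> + real p) / 2))"
  let ?k' = "Gamma ((\<nu> + real p) / 2) / (Gamma (\<nu> / 2) * sqrt ((pi * \<nu> * c) ^ p))"
  let ?dens' = "\<lambda>y. ennreal (?k' * (1 + (\<Sum>l<p. (y l)\<^sup>2) / (\<nu> * c)) powr (- (\<nu> + real p) / 2))"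
  have [measurable]: "(*v) (pinv S) \<in> borel_measurable borel"
    by (intro borel_measurable_continuous_onI continuous_intros)
  \<comment> \<open>The Jacobian of the rescaling, \<open>sqrt ((\<Prod>i<p. d i) / c ^ p)\<close>,
    trades the product of the eigenvalues for \<open>c ^ p\<close>.\<close>
  have k: "?k * (\<Prod>i<p. a i) = ?k'"
  proof -
    have "sqrt ((pi * \<nu>) ^ p * (\<Prod>i<p. d i)) = sqrt ((pi * \<nu> * c) ^ p) * (\<Prod>i<p. a i)"
    proof -
      have "(\<Prod>i<p. a i) = sqrt ((\<Prod>i<p. d i) / c ^ p)"
        unfolding a_def by (simp add: sqrt_prod_lessThan[symmetric] prod_dividef)
      then show ?thesis
        using c by (simp add: real_sqrt_mult[symmetric] power_mult_distrib)
    qed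
    moreover have "(\<Prod>i<p. a i) \<noteq> 0" using a by (simp add: less_imp_neq[symmetric])
    ultimately show ?thesis by simp
  qed
  have dens: "(\<Prod>i<p. ennreal (a i)) * ?dens (\<mu> + lincomb ?I Y y) = ?dens' y" for y
  proof -
    have "(\<Prod>i<p. ennreal (a i)) = ennreal (\<Prod>i<p. a i)"
      using a by (intro prod_ennreal) (auto simp: less_imp_le)
    moreover have "0 \<le> (\<Prod>i<p. a i)" using a by (intro prod_nonneg) (auto simp: less_imp_le)
    moreover have "ennreal P * ennreal (k * q) = ennreal ((k * P) * q)" if "0 \<le> P" for P k q
      using that by (simp add: ennreal_mult'[symmetric] mult_ac)
    ultimately have "(\<Prod>i<p. ennreal (a i)) * ?dens (\<mu> + lincomb ?I Y y) =
        ennreal ((?k * (\<Prod>i<p. a i)) * (1 + 1 / \<nu> * ((\<Sum>l<p. (y l)\<^sup>2) / c)) powr (- (\<nu> + real p) / 2))"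
      by (simp only: add_diff_cancel_left' pinv)
    then show ?thesis unfolding k by simp
  qed
  have "student \<nu> \<mu> S = density (affine_lebesgue \<mu> (range ((*v) S))) ?dens"
    unfolding student_def Let_def rank d_def[symmetric] ..
  also have "\<dots> = distr (density (leb ?I) ?dens') borel (\<lambda>y. \<mu> + lincomb ?I Y y)"
  proof (rule measure_eqI)
    fix B assume "B \<in> sets (density (affine_lebesgue \<mu> (range ((*v) S))) ?dens)"
    then have B [measurable]: "B \<in> sets borel" by simp
    have "emeasure (density (affine_lebesgue \<mu> (range ((*v) S))) ?dens) B =
        (\<integral>\<^sup>+x. ?dens x * indicator B x \<partial>affine_lebesgue \<mu> (range ((*v) S)))"
      by (subst emeasure_density) auto
    also have "\<dots> = (\<Prod>i<p. ennreal (a i)) *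
        (\<integral>\<^sup>+y. ?dens (\<mu> + lincomb ?I Y y) * indicator B (\<mu> + lincomb ?I Y y) \<partial>leb ?I)"
      by (rule aff) measurable
    also have "\<dots> = (\<integral>\<^sup>+y. ((\<Prod>i<p. ennreal (a i)) * ?dens (\<mu> + lincomb ?I Y y))
        * indicator B (\<mu> + lincomb ?I Y y) \<partial>leb ?I)"
      unfolding mult.assoc by (rule nn_integral_cmult[symmetric]) measurable
    also have "\<dots> = (\<integral>\<^sup>+y. ?dens' y * indicator B (\<mu> + lincomb ?I Y y) \<partial>leb ?I)"
      unfolding dens ..
    also have "\<dots> = emeasure (distr (density (leb ?I) ?dens') borel (\<lambda>y. \<mu> + lincomb ?I Y y)) B"
      by (subst emeasure_distr, simp, simp, subst emeasure_density)
        (auto intro!: nn_integral_cong simp: indicator_def)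
    finally show "emeasure (density (affine_lebesgue \<mu> (range ((*v) S))) ?dens) B =
      emeasure (distr (density (leb ?I) ?dens') borel (\<lambda>y. \<mu> + lincomb ?I Y y)) B" .
  qed simp
  finally show ?thesis unfolding S_def .
qed

lemma student_eq_marginal:
  fixes A :: "real ^ 'n ^ 'n" and Y :: "nat \<Rightarrow> real ^ 'n"
  assumes A: "sym_pos_def A"
    and Y: "\<And>i j. i < p \<Longrightarrow> j < p \<Longrightarrow> Y i \<bullet> (A *v Y j) = (if i = j then 1 else 0)"
    and a: "0 < a" and b: "0 < b"
  shows "student (2 * a) \<mu> ((b / a) *\<^sub>R cols_diag_cols p Y (\<lambda>_. 1)) =
    distr (density (leb {..<p}) (\<lambda>y. ennreal (marginal_density a b p (\<Sum>l<p. (y l)\<^sup>2))))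
    borel (\<lambda>y. \<mu> + lincomb {..<p} Y y)"
proof -
  have eq: "2 * a * (b / a) = 2 * b" using a by simp
  show ?thesis
    by (subst student_eq_distr[OF A Y])
      (use a b in \<open>simp_all only: eq student_density_eq_marginal[OF a b sum_nonneg[OF zero_le_power2]]\<close>, simp_all)
qed

section \<open>The joint law\<close>

text \<open>\<open>\<sigma>\<close> is the variance, whereas \<open>normal_density\<close> expects
  the standard deviation.\<close>

definition gauss_density :: "'i set \<Rightarrow> real \<Rightarrow> ('i \<Rightarrow> real) \<Rightarrow> ennreal" where
  "gauss_density I \<sigma> y = (\<Prod>i\<in>I. ennreal (normal_density 0 (sqrt \<sigma>) (y i)))"

lemma measurable_gauss_density [measurable (raw)]:
  assumes [measurable]: "\<sigma> \<in> borel_measurable M" "\<And>i. i \<in> I \<Longrightarrow> (\<lambda>x. y x i) \<in> borel_measurable M"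
  shows "(\<lambda>x. gauss_density I (\<sigma> x) (y x)) \<in> borel_measurable M"
  unfolding gauss_density_def normal_density_def by measurable

lemma measurable_prod_gauss_density [measurable (raw)]:
  fixes f :: "'a \<Rightarrow> 'k::finite \<Rightarrow> 'i \<Rightarrow> real"
  assumes [measurable]: "\<sigma> \<in> borel_measurable M"
    and f: "f \<in> M \<rightarrow>\<^sub>M Pi\<^sub>M UNIV (\<lambda>_. leb I)"
  shows "(\<lambda>x. \<Prod>j\<in>UNIV. gauss_density I (\<sigma> x) (f x j)) \<in> borel_measurable M"
proof -
  have "(\<lambda>x. f x j i) \<in> borel_measurable M" if "i \<in> I" for i j
    using measurable_compose[OF measurable_compose[OF f measurable_component_singleton[of j UNIV]]
        measurable_component_singleton[OF that]] by simp
  then show ?thesis by measurable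
qed

lemma measurable_map_leb:
  fixes e :: "('i \<Rightarrow> real) \<Rightarrow> 'b::topological_space"
  assumes "e \<in> borel_measurable (leb I)"
  shows "(\<lambda>y j. e (y j)) \<in> Pi\<^sub>M UNIV (\<lambda>_::'k. leb I) \<rightarrow>\<^sub>M Pi\<^sub>M UNIV (\<lambda>_::'k. borel)"
  using assms by (intro measurable_PiM_single') (auto simp: space_PiM)

lemma nn_integral_gauss_density:
  assumes I: "finite I" and \<sigma>: "0 < \<sigma>"
  shows "(\<integral>\<^sup>+y. gauss_density I \<sigma> y \<partial>leb I) = 1"
proof -
  have "(\<integral>\<^sup>+t. ennreal (normal_density 0 (sqrt \<sigma>) t) \<partial>lborel) = 1"
    using prob_space.emeasure_space_1[OF prob_space_normal_density[of "sqrt \<sigma>" 0]] \<sigma>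
    by (simp add: emeasure_density)
  then show ?thesis
    unfolding gauss_density_def using I by (subst leb.product_nn_integral_prod) auto
qed

lemma prob_space_gauss_density:
  "finite I \<Longrightarrow> 0 < \<sigma> \<Longrightarrow> prob_space (density (leb I) (gauss_density I \<sigma>))"
  by (rule prob_spaceI) (simp add: emeasure_density nn_integral_gauss_density
      cong: nn_integral_cong_simp)

text \<open>By Tonelli, this is the representation of the Student law as a normal law whose variance
  is mixed by an inverse gamma law.\<close>

lemma nn_integral_marginal_density:
  assumes I: "finite I" and a: "0 < a" and b: "0 < b" and f [measurable]: "f \<in> borel_measurable (leb I)"
  shows "(\<integral>\<^sup>+y. ennreal (marginal_density a b (card I) (\<Sum>i\<in>I. (y i)\<^sup>2)) * f y \<partial>leb I) =
    (\<integral>\<^sup>+\<sigma>. ennreal (ig_density a b \<sigma>) * (\<integral>\<^sup>+y. gauss_density I \<sigma> y * f y \<partial>leb I) \<partial>lborel)"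
proof -
  interpret LI: sigma_finite_measure "leb I" by (rule sigma_finite_leb[OF I])
  interpret P: pair_sigma_finite "lborel :: real measure" "leb I" ..
  have "(\<integral>\<^sup>+\<sigma>. ennreal (ig_density a b \<sigma>) * (\<integral>\<^sup>+y. gauss_density I \<sigma> y * f y \<partial>leb I) \<partial>lborel) =
      (\<integral>\<^sup>+\<sigma>. (\<integral>\<^sup>+y. ennreal (ig_density a b \<sigma>) * (gauss_density I \<sigma> y * f y) \<partial>leb I) \<partial>lborel)"
    by (intro nn_integral_cong nn_integral_cmult[symmetric]) measurable
  also have "\<dots> = (\<integral>\<^sup>+y. (\<integral>\<^sup>+\<sigma>. ennreal (ig_density a b \<sigma>) * (gauss_density I \<sigma> y * f y) \<partial>lborel) \<partial>leb I)"
    by (rule P.Fubini'[symmetric]) measurable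
  also have "\<dots> = (\<integral>\<^sup>+y. (\<integral>\<^sup>+\<sigma>. ennreal (ig_density a b \<sigma>) * gauss_density I \<sigma> y \<partial>lborel) * f y \<partial>leb I)"
    unfolding mult.assoc[symmetric] by (intro nn_integral_cong nn_integral_multc) measurable
  also have "\<dots> = (\<integral>\<^sup>+y. ennreal (marginal_density a b (card I) (\<Sum>i\<in>I. (y i)\<^sup>2)) * f y \<partial>leb I)"
    unfolding gauss_density_def by (simp add: nn_integral_ig_density_normal[OF I a b])
  finally show ?thesis ..
qed

lemma sym_pos_def_surj: "sym_pos_def A \<Longrightarrow> surj ((*v) A)" for A :: "real ^ 'n ^ 'n"
  using sym_pos_def_rank full_rank_surjective by blast

text \<open>The columns of \<open>V\<close> and \<open>Y\<close> form a nondegenerate family: a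
  vector \<open>w = A *v v\<close> orthogonal to all of them has \<open>v\<close> in the null space
  of \<open>transpose V ** A\<close>, hence in the span of \<open>Y\<close>, so
  \<open>v \<bullet> (A *v v) = 0\<close>. Placing the columns of \<open>V\<close> at indices from
  \<open>p\<close> on makes the index sets disjoint, so the integral over all coordinates
  splits.\<close>

lemma gaussian_kernel:
  fixes A :: "real ^ 'n ^ 'n" and V :: "real ^ 'm ^ 'n" and Y :: "nat \<Rightarrow> real ^ 'n"
  assumes A: "sym_pos_def A" and p: "p \<le> CARD('n)"
    and Y_range: "{v. (transpose V ** A) *v v = 0} \<subseteq> span (Y ` {..<p})"
    and h: "bij_betw h {p..<CARD('n)} (UNIV :: 'm set)" and \<sigma>: "0 < \<sigma>"
    and f [measurable]: "f \<in> borel_measurable borel"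
  shows "(\<integral>\<^sup>+x. f x \<partial>gaussian \<mu> (V ** transpose V + \<sigma> *\<^sub>R cols_diag_cols p Y (\<lambda>_. 1))) =
    (\<integral>\<^sup>+u. gauss_density {p..<CARD('n)} 1 u * (\<integral>\<^sup>+y. gauss_density {..<p} \<sigma> y *
      f (\<mu> + lincomb {p..<CARD('n)} (\<lambda>i. column (h i) V) u + lincomb {..<p} Y y) \<partial>leb {..<p})
      \<partial>leb {p..<CARD('n)})"
proof -
  let ?J = "{p..<CARD('n)}" and ?I = "{..<p}"
  let ?C = "\<lambda>i. column (h i) V"
  define B where "B i = (if i < p then Y i else ?C i)" for i
  define \<tau> where "\<tau> i = (if i < p then sqrt \<sigma> else 1)" for i
  have lc: "lincomb (?J \<union> ?I) B y = lincomb ?J ?C y + lincomb ?I Y y" for y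
    unfolding lincomb_def by (subst sum.union_disjoint) (auto simp: B_def)
  let ?S = "V ** transpose V + \<sigma> *\<^sub>R cols_diag_cols p Y (\<lambda>_. 1)"
  have "w = 0" if w: "\<And>i. i \<in> ?J \<union> ?I \<Longrightarrow> w \<bullet> B i = 0" for w
  proof -
    have wY: "w \<bullet> Y l = 0" if "l < p" for l
      using w[of l] that by (simp add: B_def)
    have wV: "w \<bullet> column j V = 0" for j
    proof -
      have "j \<in> h ` ?J" using h by (simp add: bij_betw_def)
      then obtain i where "i \<in> ?J" "j = h i" by blast
      then show ?thesis using w[of i] by (simp add: B_def)
    qed
    obtain v where v: "w = A *v v" using sym_pos_def_surj[OF A] by blast
    have "transpose V *v w = 0"
      using wV by (simp add: vec_eq_iff matrix_vector_mult_def transpose_def column_def inner_vec_def mult.commute)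
    then have "v \<in> span (Y ` ?I)"
      using Y_range by (auto simp: v matrix_vector_mul_assoc)
    then obtain y where y: "v = lincomb ?I Y y" using span_image_lincomb[of ?I] by blast
    have "w \<bullet> v = 0" unfolding y lincomb_def inner_sum_right using wY by simp
    then have "v = 0" using sym_pos_def_pos[OF A, of v] by (auto simp: v inner_commute)
    then show ?thesis by (simp add: v)
  qed
  moreover have "?S *v w = lincomb (?J \<union> ?I) B (\<lambda>i. (\<tau> i)\<^sup>2 * (w \<bullet> B i))" for w
  proof -
    have "(V ** transpose V) *v w = (\<Sum>i\<in>?J. (w \<bullet> ?C i) *\<^sub>R ?C i)"
      unfolding matrix_mult_transpose_columns by (rule sum.reindex_bij_betw[OF h, symmetric])
    then have "?S *v w = lincomb ?J ?C (\<lambda>i. w \<bullet> ?C i) + lincomb ?I Y (\<lambda>l. \<sigma> * (w \<bullet> Y l))"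
      by (simp add: matrix_vector_mult_add_rdistrib cols_diag_cols_scaleR cols_diag_cols_mult lincomb_def)
    also have "lincomb ?J ?C (\<lambda>i. w \<bullet> ?C i) = lincomb ?J ?C (\<lambda>i. (\<tau> i)\<^sup>2 * (w \<bullet> B i))"
      by (rule lincomb_cong) (simp add: \<tau>_def B_def)
    also have "lincomb ?I Y (\<lambda>l. \<sigma> * (w \<bullet> Y l)) = lincomb ?I Y (\<lambda>i. (\<tau> i)\<^sup>2 * (w \<bullet> B i))"
      by (rule lincomb_cong) (use \<sigma> in \<open>simp add: \<tau>_def B_def\<close>)
    finally show ?thesis unfolding lc .
  qed
  moreover have "card (?J \<union> ?I) = CARD('n)"
    using p by (subst card_Un_disjoint) auto
  moreover have "0 < \<tau> i" for i using \<sigma> by (simp add: \<tau>_def)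
  ultimately have "(\<integral>\<^sup>+x. f x \<partial>gaussian \<mu> ?S) =
      (\<integral>\<^sup>+y. ennreal (\<Prod>i\<in>?J \<union> ?I. normal_density 0 (\<tau> i) (y i)) * f (\<mu> + lincomb (?J \<union> ?I) B y) \<partial>leb (?J \<union> ?I))"
    by (intro nn_integral_gaussian_scaled) auto
  also have "\<dots> = (\<integral>\<^sup>+u. (\<integral>\<^sup>+y. ennreal (\<Prod>i\<in>?J \<union> ?I. normal_density 0 (\<tau> i) (merge ?J ?I (u, y) i)) *
      f (\<mu> + lincomb (?J \<union> ?I) B (merge ?J ?I (u, y))) \<partial>leb ?I) \<partial>leb ?J)"
    by (rule leb.product_nn_integral_fold) auto
  also have "\<dots> = (\<integral>\<^sup>+u. gauss_density ?J 1 u * (\<integral>\<^sup>+y. gauss_density ?I \<sigma> y *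
      f (\<mu> + lincomb ?J ?C u + lincomb ?I Y y) \<partial>leb ?I) \<partial>leb ?J)"
  proof (rule nn_integral_cong)
    fix u assume "u \<in> space (leb ?J)"
    have "ennreal (\<Prod>i\<in>?J \<union> ?I. normal_density 0 (\<tau> i) (merge ?J ?I (u, y) i)) =
        gauss_density ?J 1 u * gauss_density ?I \<sigma> y" for y
    proof -
      have "ennreal (\<Prod>i\<in>?J \<union> ?I. normal_density 0 (\<tau> i) (merge ?J ?I (u, y) i)) =
          (\<Prod>i\<in>?J \<union> ?I. ennreal (normal_density 0 (\<tau> i) (merge ?J ?I (u, y) i)))"
        by (simp add: prod_ennreal)
      also have "\<dots> = (\<Prod>i\<in>?J. ennreal (normal_density 0 (\<tau> i) (merge ?J ?I (u, y) i))) *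
          (\<Prod>i\<in>?I. ennreal (normal_density 0 (\<tau> i) (merge ?J ?I (u, y) i)))"
        by (rule prod.union_disjoint) auto
      also have "\<dots> = gauss_density ?J 1 u * gauss_density ?I \<sigma> y"
        unfolding gauss_density_def
        by (intro arg_cong2[where f="(*)"] prod.cong) (auto simp: \<tau>_def merge_def)
      finally show ?thesis .
    qed
    moreover have "lincomb (?J \<union> ?I) B (merge ?J ?I (u, y)) = lincomb ?J ?C u + lincomb ?I Y y" for y
      unfolding lc by (intro arg_cong2[where f="(+)"] lincomb_cong) (auto simp: merge_def)
    ultimately show "(\<integral>\<^sup>+y. ennreal (\<Prod>i\<in>?J \<union> ?I. normal_density 0 (\<tau> i) (merge ?J ?I (u, y) i)) *
        f (\<mu> + lincomb (?J \<union> ?I) B (merge ?J ?I (u, y))) \<partial>leb ?I) =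
      gauss_density ?J 1 u * (\<integral>\<^sup>+y. gauss_density ?I \<sigma> y * f (\<mu> + lincomb ?J ?C u + lincomb ?I Y y) \<partial>leb ?I)"
      by (simp add: mult.assoc nn_integral_cmult add.assoc)
  qed
  finally show ?thesis .
qed

text \<open>A product of image measures is the image of the product, so i.i.d. observations are
  integrated over their coordinates, one point of \<open>leb I\<close> per observation.\<close>

lemma nn_integral_PiM_distr_gauss:
  fixes e :: "('i \<Rightarrow> real) \<Rightarrow> 'b::topological_space"
  assumes I: "finite I" and \<sigma>: "0 < \<sigma>" and e [measurable]: "e \<in> borel_measurable (leb I)"
    and F [measurable]: "F \<in> borel_measurable (Pi\<^sub>M UNIV (\<lambda>_::'k::finite. borel))"
  shows "(\<integral>\<^sup>+z. F z \<partial>Pi\<^sub>M UNIV (\<lambda>_. distr (density (leb I) (gauss_density I \<sigma>)) borel e)) =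
    (\<integral>\<^sup>+y. (\<Prod>j\<in>UNIV. gauss_density I \<sigma> (y j)) * F (\<lambda>j. e (y j)) \<partial>Pi\<^sub>M UNIV (\<lambda>_. leb I))"
proof -
  let ?N = "density (leb I) (gauss_density I \<sigma>)"
  have N: "prob_space ?N" by (rule prob_space_gauss_density[OF I \<sigma>])
  interpret N: prob_space ?N by (rule N)
  have eN [measurable]: "e \<in> ?N \<rightarrow>\<^sub>M borel" by simp
  have D: "prob_space (distr ?N borel e)" by (rule N.prob_space_distr[OF eN])
  let ?e = "compose UNIV e :: ('k \<Rightarrow> _) \<Rightarrow> _"
  have e_eq: "?e = (\<lambda>y j. e (y j))" by (auto simp: compose_def fun_eq_iff)
  have "product_sigma_finite (\<lambda>_::'k. leb I)"
    unfolding product_sigma_finite_def using sigma_finite_leb[OF I] by simp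
  then have PN: "Pi\<^sub>M UNIV (\<lambda>_::'k. ?N) = density (Pi\<^sub>M UNIV (\<lambda>_. leb I)) (\<lambda>y. \<Prod>j\<in>UNIV. gauss_density I \<sigma> (y j))"
    using N.sigma_finite_measure_axioms by (intro PiM_density) auto
  have m: "(\<lambda>y j. e (y j)) \<in> Pi\<^sub>M UNIV (\<lambda>_::'k. leb I) \<rightarrow>\<^sub>M Pi\<^sub>M UNIV (\<lambda>_::'k. borel)"
    by (rule measurable_map_leb[OF e])
  have "Pi\<^sub>M UNIV (\<lambda>_::'k. distr ?N borel e) = distr (Pi\<^sub>M UNIV (\<lambda>_. ?N)) (Pi\<^sub>M UNIV (\<lambda>_. distr ?N borel e)) ?e"
    using distr_PiM_finite_prob_space'[of "UNIV :: 'k set" "\<lambda>_. ?N" "\<lambda>_. distr ?N borel e" e]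
      N D distr_cong[of ?N ?N borel "distr ?N borel e" e e] by simp
  also have "\<dots> = distr (density (Pi\<^sub>M UNIV (\<lambda>_. leb I)) (\<lambda>y. \<Prod>j\<in>UNIV. gauss_density I \<sigma> (y j)))
      (Pi\<^sub>M UNIV (\<lambda>_. borel)) (\<lambda>y j. e (y j))"
    unfolding PN e_eq by (intro distr_cong sets_PiM_cong) auto
  finally have eq: "Pi\<^sub>M UNIV (\<lambda>_::'k. distr ?N borel e) = \<dots>" .
  show ?thesis
    unfolding eq using m by (subst nn_integral_distr, simp, simp, subst nn_integral_density) auto
qed

text \<open>Integrating \<open>s\<close> against its posterior instead of its prior, by conjugacy, puts the
  observations outermost, so that both conditional laws can be read off.\<close>

lemma joint_law:
  fixes x :: "'w \<Rightarrow> 'b::euclidean_space" and Z :: "'w \<Rightarrow> 'k::finite \<Rightarrow> 'b" and \<zeta> :: "'b \<Rightarrow> 'b"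
    and I :: "'i set" and J :: "'j set"
  assumes M: "prob_space M" and s: "distr M borel s = inverse_gamma \<alpha> \<beta>"
    and law: "has_cond_law M (borel \<Otimes>\<^sub>M Pi\<^sub>M UNIV (\<lambda>_. borel)) (\<lambda>\<omega>. (x \<omega>, Z \<omega>)) borel s
      (\<lambda>\<sigma>. K \<sigma> \<Otimes>\<^sub>M Pi\<^sub>M UNIV (\<lambda>_. distr (K \<sigma>) borel \<zeta>))"
    and I: "finite I" and J: "finite J" and \<alpha>: "0 < \<alpha>" and \<beta>: "0 < \<beta>"
    and setsK: "\<And>\<sigma>. 0 < \<sigma> \<Longrightarrow> sets (K \<sigma>) = sets borel"
    and K: "\<And>\<sigma> f. 0 < \<sigma> \<Longrightarrow> f \<in> borel_measurable borel \<Longrightarrow>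
      (\<integral>\<^sup>+x. f x \<partial>K \<sigma>) = (\<integral>\<^sup>+u. gauss_density J 1 u * (\<integral>\<^sup>+y. gauss_density I \<sigma> y *
        f (\<mu> + lincomb J C u + lincomb I Y y) \<partial>leb I) \<partial>leb J)"
    and \<zeta> [measurable]: "\<zeta> \<in> borel_measurable borel"
    and \<zeta>_eq: "\<And>u y. \<zeta> (\<mu> + lincomb J C u + lincomb I Y y) = lincomb I E y"
    and F [measurable]: "F \<in> borel_measurable (borel \<Otimes>\<^sub>M (borel \<Otimes>\<^sub>M Pi\<^sub>M UNIV (\<lambda>_. borel)))"
  shows "(\<integral>\<^sup>+\<omega>. F (s \<omega>, x \<omega>, Z \<omega>) \<partial>M) =
    (\<integral>\<^sup>+w. ennreal (marginal_density \<alpha> \<beta> (CARD('k) * card I) (\<Sum>j\<in>UNIV. \<Sum>i\<in>I. (w j i)\<^sup>2)) *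
      (\<integral>\<^sup>+u. gauss_density J 1 u *
        (\<integral>\<^sup>+\<sigma>. ennreal (ig_density (\<alpha> + real CARD('k) * real (card I) / 2)
            (\<beta> + (\<Sum>j\<in>UNIV. \<Sum>i\<in>I. (w j i)\<^sup>2) / 2) \<sigma>) *
          (\<integral>\<^sup>+y. gauss_density I \<sigma> y *
            F (\<sigma>, \<mu> + lincomb J C u + lincomb I Y y, \<lambda>j. lincomb I E (w j)) \<partial>leb I) \<partial>lborel) \<partial>leb J)
      \<partial>Pi\<^sub>M UNIV (\<lambda>_::'k. leb I))"
proof -
  let ?P = "Pi\<^sub>M UNIV (\<lambda>_::'k. leb I)"
  let ?ig = "\<lambda>\<sigma>. ennreal (ig_density \<alpha> \<beta> \<sigma>)"
  let ?q = "\<lambda>w. \<Sum>j\<in>UNIV. \<Sum>i\<in>I. (w j i)\<^sup>2 :: real"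
  let ?c = "\<lambda>w. ennreal (marginal_density \<alpha> \<beta> (CARD('k) * card I) (?q w))"
  let ?ig' = "\<lambda>w \<sigma>. ennreal (ig_density (\<alpha> + real CARD('k) * real (card I) / 2) (\<beta> + ?q w / 2) \<sigma>)"
  let ?v = "\<lambda>u y. \<mu> + lincomb J C u + lincomb I Y y"
  let ?W = "\<lambda>w j. lincomb I E (w j)"
  let ?G = "\<lambda>\<sigma> w u. \<integral>\<^sup>+y. gauss_density I \<sigma> y * F (\<sigma>, ?v u y, ?W w) \<partial>leb I"
  have W [measurable]: "?W \<in> ?P \<rightarrow>\<^sub>M Pi\<^sub>M UNIV (\<lambda>_. borel)"
    by (rule measurable_map_leb) measurable
  have comp: "(\<lambda>w. w j i) \<in> borel_measurable ?P" if "i \<in> I" for i j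
    using measurable_compose[OF measurable_component_singleton[of j UNIV "\<lambda>_. leb I"]
        measurable_component_singleton[OF that]] by simp
  have q [measurable]: "?q \<in> borel_measurable ?P"
    using comp by measurable
  interpret LI: sigma_finite_measure "leb I" by (rule sigma_finite_leb[OF I])
  interpret LJ: sigma_finite_measure "leb J" by (rule sigma_finite_leb[OF J])
  interpret PP: product_sigma_finite "\<lambda>_::'k. leb I"
    by (simp add: product_sigma_finite_def LI.sigma_finite_measure_axioms)
  interpret P: sigma_finite_measure ?P by (rule PP.sigma_finite) simp
  interpret bP: pair_sigma_finite "lborel :: real measure" ?P ..
  interpret bJ: pair_sigma_finite "lborel :: real measure" "leb J" ..
  have one: "(\<integral>\<^sup>+u. gauss_density J 1 u \<partial>leb J) = 1"
    by (rule nn_integral_gauss_density[OF J]) simp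
  \<comment> \<open>\<open>\<zeta>\<close> does not see \<open>u\<close>, whose normalised integral
    drops out.\<close>
  have obs: "distr (K \<sigma>) borel \<zeta> = distr (density (leb I) (gauss_density I \<sigma>)) borel (lincomb I E)"
    if \<sigma>: "0 < \<sigma>" for \<sigma>
  proof (rule measure_eqI)
    fix B assume "B \<in> sets (distr (K \<sigma>) borel \<zeta>)"
    then have B [measurable]: "B \<in> sets borel" by simp
    have m: "\<zeta> \<in> borel_measurable (K \<sigma>)" using \<zeta> measurable_cong_sets[OF setsK[OF \<sigma>] refl] by blast
    have "emeasure (distr (K \<sigma>) borel \<zeta>) B = (\<integral>\<^sup>+x. indicator B (\<zeta> x) \<partial>K \<sigma>)"
      using m nn_integral_distr[OF m, of "indicator B"] by simp
    also have "\<dots> = (\<integral>\<^sup>+u. gauss_density J 1 u * (\<integral>\<^sup>+y. gauss_density I \<sigma> y * indicator B (lincomb I E y) \<partial>leb I) \<partial>leb J)"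
      by (subst K[OF \<sigma>]) (auto simp: \<zeta>_eq)
    also have "\<dots> = (\<integral>\<^sup>+y. gauss_density I \<sigma> y * indicator B (lincomb I E y) \<partial>leb I)"
      by (subst nn_integral_multc) (auto simp: one)
    also have "\<dots> = (\<integral>\<^sup>+y. indicator B (lincomb I E y) \<partial>density (leb I) (gauss_density I \<sigma>))"
      by (subst nn_integral_density) auto
    also have "\<dots> = emeasure (distr (density (leb I) (gauss_density I \<sigma>)) borel (lincomb I E)) B"
      using nn_integral_distr[of "lincomb I E" "density (leb I) (gauss_density I \<sigma>)" borel "indicator B"] by simp
    finally show "emeasure (distr (K \<sigma>) borel \<zeta>) B =
      emeasure (distr (density (leb I) (gauss_density I \<sigma>)) borel (lincomb I E)) B" .
  qed simp
  have inner: "(\<integral>\<^sup>+z. F (\<sigma>, z) \<partial>(K \<sigma> \<Otimes>\<^sub>M Pi\<^sub>M UNIV (\<lambda>_. distr (K \<sigma>) borel \<zeta>))) =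
      (\<integral>\<^sup>+w. (\<Prod>j\<in>UNIV. gauss_density I \<sigma> (w j)) * (\<integral>\<^sup>+u. gauss_density J 1 u * ?G \<sigma> w u \<partial>leb J) \<partial>?P)"
    if \<sigma>: "0 < \<sigma>" for \<sigma>
  proof -
    let ?Q = "Pi\<^sub>M UNIV (\<lambda>_::'k. distr (K \<sigma>) borel \<zeta>)"
    have sK [measurable_cong]: "sets (K \<sigma>) = sets borel" by (rule setsK[OF \<sigma>])
    have "emeasure (K \<sigma>) (space (K \<sigma>)) = 1"
      using K[OF \<sigma>, of "\<lambda>_. 1"] by (simp add: nn_integral_gauss_density[OF I \<sigma>] one)
    then interpret K: prob_space "K \<sigma>" by (rule prob_spaceI)
    interpret Q: prob_space ?Q
      by (intro prob_space_PiM K.prob_space_distr) measurable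
    interpret KQ: pair_sigma_finite "K \<sigma>" ?Q ..
    have sQ [measurable_cong]: "sets ?Q = sets (Pi\<^sub>M UNIV (\<lambda>_. borel))"
      by (intro sets_PiM_cong) auto
    have "(\<integral>\<^sup>+z. F (\<sigma>, z) \<partial>(K \<sigma> \<Otimes>\<^sub>M ?Q)) = (\<integral>\<^sup>+z. (\<integral>\<^sup>+x. F (\<sigma>, x, z) \<partial>K \<sigma>) \<partial>?Q)"
      by (rule KQ.nn_integral_snd[of "\<lambda>z. F (\<sigma>, z)", simplified, symmetric]) measurable
    also have "\<dots> = (\<integral>\<^sup>+z. (\<integral>\<^sup>+u. gauss_density J 1 u *
        (\<integral>\<^sup>+y. gauss_density I \<sigma> y * F (\<sigma>, ?v u y, z) \<partial>leb I) \<partial>leb J) \<partial>?Q)"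
    proof (rule nn_integral_cong)
      fix z assume "z \<in> space ?Q"
      then have "z \<in> space (Pi\<^sub>M UNIV (\<lambda>_. borel))" by (simp add: space_PiM)
      then show "(\<integral>\<^sup>+x. F (\<sigma>, x, z) \<partial>K \<sigma>) = (\<integral>\<^sup>+u. gauss_density J 1 u *
        (\<integral>\<^sup>+y. gauss_density I \<sigma> y * F (\<sigma>, ?v u y, z) \<partial>leb I) \<partial>leb J)"
        by (intro K[OF \<sigma>]) measurable
    qed
    also have "\<dots> = (\<integral>\<^sup>+w. (\<Prod>j\<in>UNIV. gauss_density I \<sigma> (w j)) * (\<integral>\<^sup>+u. gauss_density J 1 u * ?G \<sigma> w u \<partial>leb J) \<partial>?P)"
      unfolding obs[OF \<sigma>] by (rule nn_integral_PiM_distr_gauss[OF I \<sigma>]) measurable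
    finally show ?thesis .
  qed
  \<comment> \<open>All observations are read as a single sample indexed by pairs, to which
    conjugacy applies once.\<close>
  have conj: "?ig \<sigma> * (\<Prod>j\<in>UNIV. gauss_density I \<sigma> (w j)) = ?c w * ?ig' w \<sigma>" for \<sigma> and w :: "'k \<Rightarrow> 'i \<Rightarrow> real"
  proof -
    let ?y = "\<lambda>(j, i). w j i" and ?S = "(UNIV :: 'k set) \<times> I"
    have q: "(\<Sum>z\<in>?S. (?y z)\<^sup>2) = ?q w"
      by (simp add: sum.cartesian_product case_prod_beta)
    have g: "(\<Prod>j\<in>UNIV. gauss_density I \<sigma> (w j)) = ennreal (\<Prod>z\<in>?S. normal_density 0 (sqrt \<sigma>) (?y z))"
      unfolding gauss_density_def
      by (simp add: prod.cartesian_product prod_ennreal[symmetric] case_prod_beta)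
    have card: "card ?S = CARD('k) * card I" by (simp add: card_cartesian_product)
    have "?ig \<sigma> * (\<Prod>j\<in>UNIV. gauss_density I \<sigma> (w j)) =
        ennreal (ig_density \<alpha> \<beta> \<sigma> * (\<Prod>z\<in>?S. normal_density 0 (sqrt \<sigma>) (?y z)))"
      unfolding g by (rule ennreal_mult[symmetric]) (auto intro!: prod_nonneg simp: ig_density_nonneg[OF \<alpha>])
    also have "\<dots> = ?c w * ?ig' w \<sigma>"
      using ig_density_times_normal[of ?S \<alpha> \<beta> \<sigma> ?y] I \<alpha> \<beta>
      by (simp add: q card ennreal_mult'[OF marginal_density_nonneg[OF \<alpha>]])
    finally show ?thesis .
  qed
  have "(\<integral>\<^sup>+\<omega>. F (s \<omega>, x \<omega>, Z \<omega>) \<partial>M) =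
      (\<integral>\<^sup>+\<sigma>. (\<integral>\<^sup>+z. F (\<sigma>, z) \<partial>(K \<sigma> \<Otimes>\<^sub>M Pi\<^sub>M UNIV (\<lambda>_. distr (K \<sigma>) borel \<zeta>))) \<partial>inverse_gamma \<alpha> \<beta>)"
    using has_cond_law_nn_integral[OF M law F] by (simp add: s)
  also have "\<dots> = (\<integral>\<^sup>+\<sigma>. ?ig \<sigma> * (\<integral>\<^sup>+z. F (\<sigma>, z) \<partial>(K \<sigma> \<Otimes>\<^sub>M Pi\<^sub>M UNIV (\<lambda>_. distr (K \<sigma>) borel \<zeta>))) \<partial>lborel)"
    unfolding inverse_gamma_eq
  proof (rule nn_integral_density)
    let ?k = "\<lambda>\<sigma>. K \<sigma> \<Otimes>\<^sub>M Pi\<^sub>M UNIV (\<lambda>_. distr (K \<sigma>) borel \<zeta>)"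
    \<comment> \<open>\<open>K \<sigma>\<close> is described only for positive
      \<open>\<sigma>\<close>, so measurability in \<open>\<sigma>\<close> is taken from the kernel
      in \<open>law\<close>.\<close>
    have "?k \<in> borel \<rightarrow>\<^sub>M subprob_algebra (borel \<Otimes>\<^sub>M Pi\<^sub>M UNIV (\<lambda>_::'k. borel))"
      using law unfolding has_cond_law_def by (blast intro: measurable_prob_algebraD)
    then have "(\<lambda>\<sigma>. \<integral>\<^sup>+z. F (\<sigma>, z) \<partial>?k \<sigma>) \<in> borel_measurable borel"
      by (intro nn_integral_measurable_subprob_algebra2) auto
    then show "(\<lambda>\<sigma>. \<integral>\<^sup>+z. F (\<sigma>, z) \<partial>?k \<sigma>) \<in> borel_measurable lborel" by simp
  qed measurable
  also have "\<dots> = (\<integral>\<^sup>+\<sigma>. (\<integral>\<^sup>+w. ?c w * (?ig' w \<sigma> * (\<integral>\<^sup>+u. gauss_density J 1 u * ?G \<sigma> w u \<partial>leb J)) \<partial>?P) \<partial>lborel)"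
  proof (rule nn_integral_cong)
    fix \<sigma> :: real
    let ?L = "\<lambda>w. \<integral>\<^sup>+u. gauss_density J 1 u * ?G \<sigma> w u \<partial>leb J"
    show "?ig \<sigma> * (\<integral>\<^sup>+z. F (\<sigma>, z) \<partial>(K \<sigma> \<Otimes>\<^sub>M Pi\<^sub>M UNIV (\<lambda>_. distr (K \<sigma>) borel \<zeta>))) =
      (\<integral>\<^sup>+w. ?c w * (?ig' w \<sigma> * ?L w) \<partial>?P)"
    \<comment> \<open>For \<open>\<sigma> \<le> 0\<close> the prior and posterior densities are
      zero, which covers the values where \<open>K\<close> is unspecified.\<close>
    proof (cases "0 < \<sigma>")
      case True
      have "?ig \<sigma> * (\<integral>\<^sup>+w. (\<Prod>j\<in>UNIV. gauss_density I \<sigma> (w j)) * ?L w \<partial>?P) =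
          (\<integral>\<^sup>+w. ?ig \<sigma> * ((\<Prod>j\<in>UNIV. gauss_density I \<sigma> (w j)) * ?L w) \<partial>?P)"
        by (rule nn_integral_cmult[symmetric]) measurable
      then show ?thesis
        unfolding inner[OF True] by (simp add: mult.assoc[symmetric] conj)
    qed (simp add: ig_density_def)
  qed
  also have "\<dots> = (\<integral>\<^sup>+w. (\<integral>\<^sup>+\<sigma>. ?c w * (?ig' w \<sigma> * (\<integral>\<^sup>+u. gauss_density J 1 u * ?G \<sigma> w u \<partial>leb J)) \<partial>lborel) \<partial>?P)"
    by (rule bP.Fubini'[symmetric]) measurable
  also have "\<dots> = (\<integral>\<^sup>+w. ?c w * (\<integral>\<^sup>+u. gauss_density J 1 u * (\<integral>\<^sup>+\<sigma>. ?ig' w \<sigma> * ?G \<sigma> w u \<partial>lborel) \<partial>leb J) \<partial>?P)"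
  proof (rule nn_integral_cong)
    fix w assume w [measurable]: "w \<in> space ?P"
    have [measurable]: "?W w \<in> space (Pi\<^sub>M UNIV (\<lambda>_. borel))" by (simp add: space_PiM)
    have "(\<integral>\<^sup>+\<sigma>. ?c w * (?ig' w \<sigma> * (\<integral>\<^sup>+u. gauss_density J 1 u * ?G \<sigma> w u \<partial>leb J)) \<partial>lborel) =
        ?c w * (\<integral>\<^sup>+\<sigma>. ?ig' w \<sigma> * (\<integral>\<^sup>+u. gauss_density J 1 u * ?G \<sigma> w u \<partial>leb J) \<partial>lborel)"
      by (rule nn_integral_cmult) measurable
    also have "(\<integral>\<^sup>+\<sigma>. ?ig' w \<sigma> * (\<integral>\<^sup>+u. gauss_density J 1 u * ?G \<sigma> w u \<partial>leb J) \<partial>lborel) =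
        (\<integral>\<^sup>+\<sigma>. (\<integral>\<^sup>+u. ?ig' w \<sigma> * (gauss_density J 1 u * ?G \<sigma> w u) \<partial>leb J) \<partial>lborel)"
      by (intro nn_integral_cong nn_integral_cmult[symmetric]) measurable
    also have "\<dots> = (\<integral>\<^sup>+u. (\<integral>\<^sup>+\<sigma>. ?ig' w \<sigma> * (gauss_density J 1 u * ?G \<sigma> w u) \<partial>lborel) \<partial>leb J)"
      by (rule bJ.Fubini'[symmetric]) measurable
    also have "\<dots> = (\<integral>\<^sup>+u. gauss_density J 1 u * (\<integral>\<^sup>+\<sigma>. ?ig' w \<sigma> * ?G \<sigma> w u \<partial>lborel) \<partial>leb J)"
      unfolding mult.left_commute[of "?ig' w _"]
      by (intro nn_integral_cong nn_integral_cmult) measurable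
    finally show "(\<integral>\<^sup>+\<sigma>. ?c w * (?ig' w \<sigma> * (\<integral>\<^sup>+u. gauss_density J 1 u * ?G \<sigma> w u \<partial>leb J)) \<partial>lborel) =
      ?c w * (\<integral>\<^sup>+u. gauss_density J 1 u * (\<integral>\<^sup>+\<sigma>. ?ig' w \<sigma> * ?G \<sigma> w u \<partial>lborel) \<partial>leb J)" .
  qed
  finally show ?thesis .
qed

section \<open>Posterior and predictive laws as probability kernels\<close>

lemma measurable_prob_algebraI_emeasure:
  assumes "\<And>x. x \<in> space M \<Longrightarrow> prob_space (\<kappa> x)" "\<And>x. x \<in> space M \<Longrightarrow> sets (\<kappa> x) = sets N"
    and "\<And>B. B \<in> sets N \<Longrightarrow> (\<lambda>x. emeasure (\<kappa> x) B) \<in> borel_measurable M"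
  shows "\<kappa> \<in> M \<rightarrow>\<^sub>M prob_algebra N"
  using assms by (intro measurable_prob_algebraI measurable_subprob_algebra)
    (auto intro: prob_space_imp_subprob_space)

lemma emeasure_inverse_gamma:
  assumes "B \<in> sets borel"
  shows "emeasure (inverse_gamma a b) B = (\<integral>\<^sup>+\<sigma>. ennreal (ig_density a b \<sigma>) * indicator B \<sigma> \<partial>lborel)"
  using assms unfolding inverse_gamma_eq by (subst emeasure_density) auto

lemma measurable_inverse_gamma:
  assumes [measurable]: "b \<in> borel_measurable M" and b: "\<And>x. 0 < b x" and a: "0 < a"
  shows "(\<lambda>x. inverse_gamma a (b x)) \<in> M \<rightarrow>\<^sub>M prob_algebra borel"
  using a b by (intro measurable_prob_algebraI_emeasure)
    (auto simp: prob_space_inverse_gamma emeasure_inverse_gamma)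

lemma nn_integral_ig_gauss:
  assumes "finite I" "0 < a" "0 < b"
  shows "(\<integral>\<^sup>+\<sigma>. ennreal (ig_density a b \<sigma>) * (\<integral>\<^sup>+y. gauss_density I \<sigma> y * c \<partial>leb I) \<partial>lborel) = c"
proof -
  have "ennreal (ig_density a b \<sigma>) * (\<integral>\<^sup>+y. gauss_density I \<sigma> y * c \<partial>leb I) = ennreal (ig_density a b \<sigma>) * c" for \<sigma>
    using assms(1) by (cases "0 < \<sigma>") (simp_all add: nn_integral_multc nn_integral_gauss_density ig_density_def)
  then show ?thesis using assms by (simp add: nn_integral_multc nn_integral_ig_density)
qed

text \<open>The Student law in terms of the frame \<open>Y\<close>, free of choices, so that its
  measurability in \<open>b\<close> and \<open>\<mu>\<close> can be read off from an
  integral.\<close>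

definition student_law :: "'i set \<Rightarrow> ('i \<Rightarrow> 'a::euclidean_space) \<Rightarrow> real \<Rightarrow> real \<Rightarrow> 'a \<Rightarrow> 'a measure" where
  "student_law I Y a b \<mu> =
    distr (density (leb I) (\<lambda>y. ennreal (marginal_density a b (card I) (\<Sum>i\<in>I. (y i)\<^sup>2)))) borel (\<lambda>y. \<mu> + lincomb I Y y)"

lemma emeasure_student_law:
  assumes B [measurable]: "B \<in> sets borel"
  shows "emeasure (student_law I Y a b \<mu>) B =
    (\<integral>\<^sup>+y. ennreal (marginal_density a b (card I) (\<Sum>i\<in>I. (y i)\<^sup>2)) * indicator B (\<mu> + lincomb I Y y) \<partial>leb I)"
  unfolding student_law_def
  by (subst emeasure_distr, simp, simp, subst emeasure_density)
    (auto intro!: nn_integral_cong simp: indicator_def)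

lemma emeasure_student_law_mixture:
  assumes I: "finite I" and a: "0 < a" and b: "0 < b" and B [measurable]: "B \<in> sets borel"
  shows "emeasure (student_law I Y a b \<mu>) B =
    (\<integral>\<^sup>+\<sigma>. ennreal (ig_density a b \<sigma>) * (\<integral>\<^sup>+y. gauss_density I \<sigma> y * indicator B (\<mu> + lincomb I Y y) \<partial>leb I) \<partial>lborel)"
  unfolding emeasure_student_law[OF B] by (rule nn_integral_marginal_density[OF I a b]) measurable

lemma measurable_student_law:
  fixes \<mu> :: "'a \<Rightarrow> 'b::euclidean_space"
  assumes I: "finite I" and a: "0 < a" and b: "\<And>x. 0 < b x"
    and [measurable]: "b \<in> borel_measurable M" "\<mu> \<in> borel_measurable M"
  shows "(\<lambda>x. student_law I Y a (b x) (\<mu> x)) \<in> M \<rightarrow>\<^sub>M prob_algebra borel"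
proof (rule measurable_prob_algebraI_emeasure)
  fix x
  have sp: "space (student_law I Y a (b x) (\<mu> x)) = UNIV" by (simp add: student_law_def)
  have "emeasure (student_law I Y a (b x) (\<mu> x)) UNIV = 1"
    using nn_integral_ig_gauss[OF I a b[of x], where c=1] by (simp add: emeasure_student_law_mixture[OF I a b])
  then show "prob_space (student_law I Y a (b x) (\<mu> x))"
    by (intro prob_spaceI) (simp add: sp)
  show "sets (student_law I Y a (b x) (\<mu> x)) = sets borel" by (simp add: student_law_def)
next
  interpret LI: sigma_finite_measure "leb I" by (rule sigma_finite_leb[OF I])
  fix B :: "'b set" assume B [measurable]: "B \<in> sets borel"
  show "(\<lambda>x. emeasure (student_law I Y a (b x) (\<mu> x)) B) \<in> borel_measurable M"
    unfolding emeasure_student_law[OF B] by measurable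
qed

lemma trace_transpose_mult_self:
  fixes z :: "real ^ 'k ^ 'n"
  shows "trace (transpose z ** z) = (\<Sum>j\<in>UNIV. column j z \<bullet> column j z)"
  by (simp add: trace_def matrix_matrix_mult_def transpose_def column_def inner_vec_def)

text \<open>The observations are modelled as a family of columns, while the conditioning variable is
  a matrix; this passes from the product sigma-algebra to the Borel one.\<close>

lemma measurable_columns_to_matrix [measurable]:
  "(\<lambda>z. \<chi> i j. z j $ i) \<in> Pi\<^sub>M UNIV (\<lambda>_::'k. borel :: (real ^ 'n) measure) \<rightarrow>\<^sub>M (borel :: (real ^ 'k ^ 'n) measure)"
proof (subst borel_measurable_euclidean_space, rule ballI)
  fix b :: "real ^ 'k ^ 'n" assume "b \<in> Basis"
  then obtain i j where b: "b = axis i (axis j 1)" by (auto simp: Basis_vec_def)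
  have "(\<lambda>v :: real ^ 'n. v $ i) \<in> borel_measurable borel"
    by (intro borel_measurable_continuous_onI continuous_intros)
  from measurable_compose[OF measurable_component_singleton[of j UNIV "\<lambda>_. borel"] this]
  show "(\<lambda>z. (\<chi> i j. z j $ i) \<bullet> b) \<in> borel_measurable (Pi\<^sub>M UNIV (\<lambda>_::'k. borel :: (real ^ 'n) measure))"
    by (simp add: b inner_axis)
qed

text \<open>A conditional law is fixed only up to null sets, so a version \<open>\<kappa>\<close> is
  asserted. As \<open>V\<close> has full rank, \<open>transpose W\<close> is onto, and every value
  of \<open>\<kappa>\<close> is prescribed.\<close>

theorem lemma8:
  fixes A :: "real ^ 'n ^ 'n"
    and V W :: "real ^ 'm ^ 'n"
    and Y :: "nat \<Rightarrow> real ^ 'n"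
    and P1 :: "real ^ 'n ^ 'n"
    and x0 :: "real ^ 'n"
    and p :: nat
    and \<alpha> \<beta> \<alpha>t :: real
    and \<beta>t :: "real ^ 'k ^ 'n \<Rightarrow> real"
    and xt :: "real ^ 'n \<Rightarrow> real ^ 'n"
    and M :: "'w measure"
    and s :: "'w \<Rightarrow> real"
    and x :: "'w \<Rightarrow> real ^ 'n"
    and Z :: "'w \<Rightarrow> real ^ 'k ^ 'n"
    and K :: "real \<Rightarrow> (real ^ 'n) measure"
  assumes m_le_n: "CARD('m) \<le> CARD('n)"
    and A: "sym_pos_def A"
    and V: "rank V = CARD('m)"
    and W: "W = V"
    and p: "p = CARD('n) - CARD('m)"
    and Y_range: "span (Y ` {..<p}) = {v. (transpose W ** A) *v v = 0}"
    and Y_orth: "\<forall>i<p. \<forall>j<p. Y i \<bullet> (A *v Y j) = (if i = j then 1 else 0)"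
    and P1: "P1 = mat 1 - V ** matrix_inv (transpose W ** A ** V) ** transpose W ** A"
    and \<alpha>: "0 < \<alpha>" and \<beta>: "0 < \<beta>"
    and M: "prob_space M"
    and s: "s \<in> borel_measurable M" "distr M borel s = inverse_gamma \<alpha> \<beta>"
    and K: "\<And>\<sigma>. 0 < \<sigma> \<Longrightarrow>
      K \<sigma> = gaussian x0 (V ** transpose V + \<sigma> *\<^sub>R cols_diag_cols p Y (\<lambda>_. 1))"
    and x_given_s: "has_cond_law M borel x borel s K"
    and x_Z_given_s: "has_cond_law M
      (borel \<Otimes>\<^sub>M Pi\<^sub>M UNIV (\<lambda>_. borel)) (\<lambda>\<omega>. (x \<omega>, \<lambda>j. column j (Z \<omega>)))
      borel s
      (\<lambda>\<sigma>. K \<sigma> \<Otimes>\<^sub>M Pi\<^sub>M UNIV (\<lambda>_. distr (K \<sigma>) borel (\<lambda>y. (matrix_sqrt A ** P1) *v (y - x0))))"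
    and \<alpha>t: "\<alpha>t = \<alpha> + real CARD('k) * real p / 2"
    and \<beta>t: "\<And>z. \<beta>t z = \<beta> + trace (transpose z ** z) / 2"
    and xt: "\<And>b. xt b =
      x0 + (V ** matrix_inv (transpose W ** A ** V) ** transpose W) *v (b - A *v x0)"
  shows "has_cond_law M borel s borel Z (\<lambda>z. inverse_gamma \<alpha>t (\<beta>t z)) \<and>
    (\<exists>\<kappa>. has_cond_law M borel x
           (borel \<Otimes>\<^sub>M borel) (\<lambda>\<omega>. ((transpose W ** A) *v x \<omega>, Z \<omega>)) \<kappa> \<and>
         (\<forall>b z. \<kappa> (transpose W *v b, z) =
            student (2 * \<alpha>t) (xt b) ((\<beta>t z / \<alpha>t) *\<^sub>R cols_diag_cols p Y (\<lambda>_. 1))))"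
proof -
  interpret M: prob_space M by (rule M)
  let ?I = "{..<p}" and ?J = "{p..<CARD('n)}"
  interpret LI: sigma_finite_measure "leb ?I" by (rule sigma_finite_leb) simp
  have W_eq: "W = V" by (rule W)
  have p_le: "p \<le> CARD('n)" by (simp add: p)
  \<comment> \<open>The subtraction defining \<open>p\<close> is exact because
    \<open>CARD('m) \<le> CARD('n)\<close>.\<close>
  have "card ?J = CARD('m)" using m_le_n by (simp add: p)
  then obtain h where h: "bij_betw h ?J (UNIV :: 'm set)"
    using finite_same_card_bij[of ?J "UNIV :: 'm set"] by auto
  define C where "C i = column (h i) V" for i
  define R where "R = matrix_sqrt A"
  define E where "E l = R *v Y l" for l
  define N where "N = transpose V ** A ** V"
  \<comment> \<open>\<open>G ** B\<close>, with \<open>B\<close> below, is the projection onto the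
    range of \<open>V\<close> along the span of \<open>Y\<close>, and \<open>P1\<close> is its
    complement.\<close>
  define G where "G = V ** matrix_inv N"
  define B where "B = transpose V ** A"
  have V_inj: "v = 0" if "V *v v = 0" for v
    using V that matrix_nonfull_linear_equations_eq by metis
  have "v = 0" if "N *v v = 0" for v
  proof -
    have "(V *v v) \<bullet> (A *v (V *v v)) = v \<bullet> (N *v v)"
      by (simp only: N_def matrix_vector_mul_assoc[symmetric] inner_transpose_mult transpose_transpose)
    then have "V *v v = 0" using that sym_pos_def_pos[OF A, of "V *v v"] by fastforce
    then show ?thesis by (rule V_inj)
  qed
  then obtain N' where N': "N' ** N = mat 1"
    using matrix_left_invertible_ker[of N] by blast
  then have "N ** N' = mat 1" using matrix_left_right_inverse by blast
  \<comment> \<open>\<open>matrix_inv\<close> picks some two-sided inverse, so one has to be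
    presented before the choice can be used.\<close>
  from someI[of "\<lambda>X. N ** X = mat 1 \<and> X ** N = mat 1", OF conjI[OF this N']]
  have N_inv: "matrix_inv N ** N = mat 1" unfolding matrix_inv_def by (rule conjunct2)
  have GBV: "G *v (B *v (V *v v)) = V *v v" for v
  proof -
    have "G *v (B *v (V *v v)) = V *v ((matrix_inv N ** N) *v v)"
      by (simp only: G_def B_def N_def matrix_vector_mul_assoc matrix_mul_assoc)
    then show ?thesis by (simp add: N_inv)
  qed
  have BY: "B *v lincomb ?I Y y = 0" for y
    using lincomb_in_span[of ?I Y y] unfolding Y_range by (simp add: B_def W_eq)
  have GBC: "G *v (B *v lincomb ?J C u) = lincomb ?J C u" for u
  proof -
    have "V *v lincomb ?J (\<lambda>i. axis (h i) 1) u = lincomb ?J C u"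
      unfolding C_def by (subst linear_lincomb) (simp_all add: matrix_vector_mult_basis)
    then show ?thesis using GBV by metis
  qed
  have P1_eq: "P1 *v v = v - G *v (B *v v)" for v
    by (simp add: P1 W_eq G_def B_def N_def matrix_vector_mult_diff_rdistrib matrix_vector_mul_assoc matrix_mul_assoc)
  define \<zeta> where "\<zeta> y = (matrix_sqrt A ** P1) *v (y - x0)" for y
  have [measurable]: "(*v) D \<in> borel_measurable borel" for D :: "real ^ 'c::finite ^ 'd::finite"
    by (intro borel_measurable_continuous_onI continuous_intros)
  have \<zeta>_meas: "\<zeta> \<in> borel_measurable borel" unfolding \<zeta>_def by measurable
  have \<zeta>_eq: "\<zeta> (x0 + lincomb ?J C u + lincomb ?I Y y) = lincomb ?I E y" for u y
  proof -
    have "P1 *v (lincomb ?J C u + lincomb ?I Y y) = lincomb ?I Y y"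
      by (simp add: P1_eq matrix_vector_right_distrib GBC BY)
    then have "\<zeta> (x0 + lincomb ?J C u + lincomb ?I Y y) = R *v lincomb ?I Y y"
      by (simp add: \<zeta>_def R_def matrix_vector_mul_assoc[symmetric] add.assoc)
    also have "\<dots> = lincomb ?I E y" unfolding E_def by (rule linear_lincomb) simp
    finally show ?thesis .
  qed
  have E: "orthonormal_on ?I E"
    using Y_orth by (simp add: orthonormal_on_def E_def R_def matrix_sqrt_inner[OF A])
  have K_int: "(\<integral>\<^sup>+x. f x \<partial>K \<sigma>) = (\<integral>\<^sup>+u. gauss_density ?J 1 u * (\<integral>\<^sup>+y. gauss_density ?I \<sigma> y *
      f (x0 + lincomb ?J C u + lincomb ?I Y y) \<partial>leb ?I) \<partial>leb ?J)"
    if "0 < \<sigma>" "f \<in> borel_measurable borel" for \<sigma> f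
    unfolding K[OF that(1)] C_def
    using Y_range by (intro gaussian_kernel[OF A p_le _ h that]) (simp add: W_eq)
  have K_sets: "sets (K \<sigma>) = sets borel" if "0 < \<sigma>" for \<sigma>
    unfolding K[OF that] by (simp add: gaussian_def Let_def)
  define cols :: "'w \<Rightarrow> 'k \<Rightarrow> real ^ 'n" where "cols \<omega> = (\<lambda>j. column j (Z \<omega>))" for \<omega>
  define \<Phi> :: "('k \<Rightarrow> real ^ 'n) \<Rightarrow> real ^ 'k ^ 'n" where "\<Phi> z = (\<chi> i j. z j $ i)" for z
  have \<Phi>_cols: "\<Phi> (cols \<omega>) = Z \<omega>" for \<omega>
    by (simp add: \<Phi>_def cols_def column_def vec_eq_iff)
  have column_\<Phi>: "column j (\<Phi> z) = z j" for j z
    by (simp add: \<Phi>_def column_def vec_eq_iff)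
  have \<Phi> [measurable]: "\<Phi> \<in> Pi\<^sub>M UNIV (\<lambda>_. borel) \<rightarrow>\<^sub>M borel"
    unfolding \<Phi>_def by (rule measurable_columns_to_matrix)
  have law: "has_cond_law M (borel \<Otimes>\<^sub>M Pi\<^sub>M UNIV (\<lambda>_. borel)) (\<lambda>\<omega>. (x \<omega>, cols \<omega>)) borel s
      (\<lambda>\<sigma>. K \<sigma> \<Otimes>\<^sub>M Pi\<^sub>M UNIV (\<lambda>_. distr (K \<sigma>) borel \<zeta>))"
    using x_Z_given_s unfolding cols_def \<zeta>_def .
  then have xc: "(\<lambda>\<omega>. (x \<omega>, cols \<omega>)) \<in> M \<rightarrow>\<^sub>M borel \<Otimes>\<^sub>M Pi\<^sub>M UNIV (\<lambda>_. borel)"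
    by (simp add: has_cond_law_def)
  have x [measurable]: "x \<in> borel_measurable M"
    using measurable_compose[OF xc measurable_fst] by simp
  have cols [measurable]: "cols \<in> M \<rightarrow>\<^sub>M Pi\<^sub>M UNIV (\<lambda>_. borel)"
    using measurable_compose[OF xc measurable_snd] by simp
  have Z [measurable]: "Z \<in> borel_measurable M"
    using measurable_compose[OF cols \<Phi>] by (simp add: \<Phi>_cols)
  note s(1) [measurable]
  let ?P = "Pi\<^sub>M UNIV (\<lambda>_::'k. leb ?I)"
  define q where "q w = (\<Sum>j\<in>UNIV. \<Sum>l<p. (w j l)\<^sup>2 :: real)" for w :: "'k \<Rightarrow> nat \<Rightarrow> real"
  \<comment> \<open>\<open>c\<close> is the evidence for the observations with coordinates
    \<open>w\<close>, \<open>H w\<close> their matrix, and \<open>X u\<close> the part of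
    \<open>x\<close> fixed by the condition.\<close>
  define c where "c w = ennreal (marginal_density \<alpha> \<beta> (CARD('k) * p) (q w))" for w
  define g where "g = gauss_density ?J 1"
  define H where "H w = \<Phi> (\<lambda>j. lincomb ?I E (w j))" for w :: "'k \<Rightarrow> nat \<Rightarrow> real"
  define X where "X u = x0 + lincomb ?J C u" for u
  have g1: "(\<integral>\<^sup>+u. g u \<partial>leb ?J) = 1"
    unfolding g_def by (rule nn_integral_gauss_density) auto
  have g_meas [measurable]: "g \<in> borel_measurable (leb ?J)" unfolding g_def by measurable
  have \<beta>t_H: "\<beta>t (H w) = \<beta> + q w / 2" for w
    by (simp add: \<beta>t trace_transpose_mult_self H_def column_\<Phi> q_def orthonormal_inner_lincomb[OF _ E])
  have \<beta>t_pos: "0 < \<beta>t z" for z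
    using \<beta> by (simp add: \<beta>t trace_transpose_mult_self add_pos_nonneg sum_nonneg)
  have \<alpha>t_pos: "0 < \<alpha>t" using \<alpha> by (simp add: \<alpha>t add_pos_nonneg)
  have \<beta>t_meas [measurable]: "\<beta>t \<in> borel_measurable borel"
    unfolding \<beta>t[abs_def] trace_def matrix_matrix_mult_def transpose_def
    by (intro borel_measurable_continuous_onI) (simp, intro continuous_intros, simp)
  have joint: "(\<integral>\<^sup>+\<omega>. F (s \<omega>, x \<omega>, cols \<omega>) \<partial>M) = (\<integral>\<^sup>+w. c w * (\<integral>\<^sup>+u. g u *
      (\<integral>\<^sup>+\<sigma>. ennreal (ig_density \<alpha>t (\<beta>t (H w)) \<sigma>) * (\<integral>\<^sup>+y. gauss_density ?I \<sigma> y *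
        F (\<sigma>, X u + lincomb ?I Y y, \<lambda>j. lincomb ?I E (w j)) \<partial>leb ?I) \<partial>lborel) \<partial>leb ?J) \<partial>?P)"
    if "F \<in> borel_measurable (borel \<Otimes>\<^sub>M (borel \<Otimes>\<^sub>M Pi\<^sub>M UNIV (\<lambda>_. borel)))" for F
    unfolding c_def g_def \<beta>t_H X_def \<alpha>t q_def
    by (rule joint_law[OF M s(2) law finite_lessThan finite_atLeastLessThan \<alpha> \<beta> K_sets K_int \<zeta>_meas \<zeta>_eq that,
        unfolded card_lessThan])
  have ig1: "(\<integral>\<^sup>+\<sigma>. ennreal (ig_density \<alpha>t (\<beta>t z) \<sigma>) * (\<integral>\<^sup>+y. gauss_density ?I \<sigma> y * a \<partial>leb ?I) \<partial>lborel) = a"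
    for z a
    by (rule nn_integral_ig_gauss) (auto simp: \<alpha>t_pos \<beta>t_pos)
  \<comment> \<open>Integrands that ignore \<open>s\<close> and \<open>x\<close> let the posterior
    and both Gaussian factors integrate to 1. The weight \<open>c\<close> that remains is the one in
    \<open>joint\<close>, so nothing has to be divided by it.\<close>
  have law_Z: "(\<integral>\<^sup>+z. f z \<partial>distr M borel Z) = (\<integral>\<^sup>+w. c w * f (H w) \<partial>?P)"
    if [measurable]: "f \<in> borel_measurable borel" for f
  proof -
    have "(\<integral>\<^sup>+z. f z \<partial>distr M borel Z) = (\<integral>\<^sup>+\<omega>. f (\<Phi> (cols \<omega>)) \<partial>M)"
      by (subst nn_integral_distr) (auto simp: \<Phi>_cols)
    also have "\<dots> = (\<integral>\<^sup>+w. c w * f (H w) \<partial>?P)"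
      using joint[of "\<lambda>z. f (\<Phi> (snd (snd z)))"]
      by (simp add: ig1 H_def[symmetric]) (simp add: nn_integral_multc g1)
    finally show ?thesis .
  qed
  have law_T: "(\<integral>\<^sup>+t. f t \<partial>distr M (borel \<Otimes>\<^sub>M borel) (\<lambda>\<omega>. (B *v x \<omega>, Z \<omega>))) =
      (\<integral>\<^sup>+w. c w * (\<integral>\<^sup>+u. g u * f (B *v X u, H w) \<partial>leb ?J) \<partial>?P)"
    if [measurable]: "f \<in> borel_measurable (borel \<Otimes>\<^sub>M borel)" for f
  proof -
    have "(\<integral>\<^sup>+t. f t \<partial>distr M (borel \<Otimes>\<^sub>M borel) (\<lambda>\<omega>. (B *v x \<omega>, Z \<omega>))) =
        (\<integral>\<^sup>+\<omega>. f (B *v x \<omega>, \<Phi> (cols \<omega>)) \<partial>M)"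
      by (subst nn_integral_distr) (auto simp: \<Phi>_cols)
    also have "\<dots> = (\<integral>\<^sup>+w. c w * (\<integral>\<^sup>+u. g u * f (B *v X u, H w) \<partial>leb ?J) \<partial>?P)"
      using joint[of "\<lambda>z. f (B *v fst (snd z), \<Phi> (snd (snd z)))"]
      by (simp add: matrix_vector_right_distrib BY ig1 H_def[symmetric])
    finally show ?thesis .
  qed
  have post: "has_cond_law M borel s borel Z (\<lambda>z. inverse_gamma \<alpha>t (\<beta>t z))"
    unfolding has_cond_law_def
  proof (intro conjI ballI)
    show "(\<lambda>z. inverse_gamma \<alpha>t (\<beta>t z)) \<in> borel \<rightarrow>\<^sub>M prob_algebra borel"
      by (rule measurable_inverse_gamma[OF _ \<beta>t_pos \<alpha>t_pos]) measurable
    fix S :: "real set" and D :: "(real ^ 'k ^ 'n) set"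
    assume S [measurable]: "S \<in> sets borel" and D [measurable]: "D \<in> sets borel"
    let ?f = "\<lambda>z. emeasure (inverse_gamma \<alpha>t (\<beta>t z)) S * indicator D z"
    have [measurable]: "(\<lambda>z. emeasure (inverse_gamma \<alpha>t (\<beta>t z)) S) \<in> borel_measurable borel"
      unfolding emeasure_inverse_gamma[OF S] by measurable
    have gauss1: "ennreal (ig_density \<alpha>t b \<sigma>) * (\<integral>\<^sup>+y. gauss_density ?I \<sigma> y * a \<partial>leb ?I) =
        ennreal (ig_density \<alpha>t b \<sigma>) * a" for b \<sigma> a
      by (cases "0 < \<sigma>") (simp_all add: nn_integral_multc nn_integral_gauss_density ig_density_def)
    have "emeasure M {\<omega> \<in> space M. s \<omega> \<in> S \<and> Z \<omega> \<in> D} =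
        (\<integral>\<^sup>+\<omega>. indicator {\<omega> \<in> space M. s \<omega> \<in> S \<and> Z \<omega> \<in> D} \<omega> \<partial>M)"
      by (rule nn_integral_indicator[symmetric]) measurable
    also have "\<dots> = (\<integral>\<^sup>+\<omega>. indicator S (s \<omega>) * indicator D (\<Phi> (cols \<omega>)) \<partial>M)"
      by (rule nn_integral_cong) (auto simp: \<Phi>_cols indicator_def)
    also have "\<dots> = (\<integral>\<^sup>+w. c w * ?f (H w) \<partial>?P)"
      using joint[of "\<lambda>z. indicator S (fst z) * indicator D (\<Phi> (snd (snd z)))"]
      by (simp add: gauss1 H_def[symmetric] emeasure_inverse_gamma[OF S])
        (simp add: nn_integral_multc g1 mult.assoc[symmetric])
    also have "\<dots> = (\<integral>\<^sup>+z. ?f z \<partial>distr M borel Z)"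
      by (rule law_Z[symmetric]) measurable
    finally show "emeasure M {\<omega> \<in> space M. s \<omega> \<in> S \<and> Z \<omega> \<in> D} = (\<integral>\<^sup>+z. ?f z \<partial>distr M borel Z)" .
  qed measurable
  \<comment> \<open>For \<open>t = B *v X u\<close> the location is \<open>X u\<close>, as
    \<open>GBC\<close> recovers \<open>lincomb ?J C u\<close> from its image under
    \<open>B\<close>.\<close>
  define \<kappa> where "\<kappa> t = student_law ?I Y \<alpha>t (\<beta>t (snd t)) (x0 + G *v (fst t - B *v x0))"
    for t :: "(real ^ 'm) \<times> (real ^ 'k ^ 'n)"
  have \<kappa>_X: "\<kappa> (B *v X u, z) = student_law ?I Y \<alpha>t (\<beta>t z) (X u)" for u z
    by (simp add: \<kappa>_def X_def matrix_vector_right_distrib GBC)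
  have \<kappa>_eq: "\<kappa> (transpose W *v b, z) = student (2 * \<alpha>t) (xt b) ((\<beta>t z / \<alpha>t) *\<^sub>R cols_diag_cols p Y (\<lambda>_. 1))"
    for b z
  proof -
    have "x0 + G *v (transpose W *v b - B *v x0) = xt b"
      by (simp add: xt W_eq G_def B_def N_def matrix_vector_mul_assoc[symmetric] matrix_vector_mult_diff_distrib)
    moreover have "student (2 * \<alpha>t) (xt b) ((\<beta>t z / \<alpha>t) *\<^sub>R cols_diag_cols p Y (\<lambda>_. 1)) =
        student_law ?I Y \<alpha>t (\<beta>t z) (xt b)"
      using Y_orth student_eq_marginal[OF A _ \<alpha>t_pos \<beta>t_pos, of p Y "xt b" z]
      by (simp add: student_law_def)
    ultimately show ?thesis by (simp add: \<kappa>_def)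
  qed
  have \<kappa>_meas: "\<kappa> \<in> borel \<Otimes>\<^sub>M borel \<rightarrow>\<^sub>M prob_algebra borel"
    unfolding \<kappa>_def by (rule measurable_student_law[OF _ \<alpha>t_pos \<beta>t_pos]) (simp, measurable)
  have pred: "has_cond_law M borel x (borel \<Otimes>\<^sub>M borel) (\<lambda>\<omega>. (B *v x \<omega>, Z \<omega>)) \<kappa>"
    unfolding has_cond_law_def
  proof (intro conjI ballI)
    show "\<kappa> \<in> borel \<Otimes>\<^sub>M borel \<rightarrow>\<^sub>M prob_algebra borel" by (rule \<kappa>_meas)
    fix S :: "(real ^ 'n) set" and D :: "((real ^ 'm) \<times> (real ^ 'k ^ 'n)) set"
    assume S [measurable]: "S \<in> sets borel" and D [measurable]: "D \<in> sets (borel \<Otimes>\<^sub>M borel)"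
    let ?f = "\<lambda>t. emeasure (\<kappa> t) S * indicator D t"
    have [measurable]: "(\<lambda>t. emeasure (\<kappa> t) S) \<in> borel_measurable (borel \<Otimes>\<^sub>M borel)"
      using measurable_compose[OF measurable_prob_algebraD[OF \<kappa>_meas] measurable_emeasure_subprob_algebra[OF S]] .
    \<comment> \<open>\<open>B *v x\<close> does not depend on \<open>y\<close>, so the indicator of
      the condition is a constant \<open>a\<close> here; the remaining mixture over the posterior is
      the Student law centred at \<open>X u\<close>.\<close>
    have pull: "(\<integral>\<^sup>+\<sigma>. ennreal (ig_density \<alpha>t (\<beta>t z) \<sigma>) * (\<integral>\<^sup>+y. gauss_density ?I \<sigma> y *
        (indicator S (X u + lincomb ?I Y y) * a) \<partial>leb ?I) \<partial>lborel) = emeasure (\<kappa> (B *v X u, z)) S * a" for u z a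
      unfolding \<kappa>_X
      by (simp add: emeasure_student_law_mixture \<alpha>t_pos \<beta>t_pos nn_integral_multc mult.assoc[symmetric])
    have "emeasure M {\<omega> \<in> space M. x \<omega> \<in> S \<and> (B *v x \<omega>, Z \<omega>) \<in> D} =
        (\<integral>\<^sup>+\<omega>. indicator {\<omega> \<in> space M. x \<omega> \<in> S \<and> (B *v x \<omega>, Z \<omega>) \<in> D} \<omega> \<partial>M)"
      by (rule nn_integral_indicator[symmetric]) measurable
    also have "\<dots> = (\<integral>\<^sup>+\<omega>. indicator S (x \<omega>) * indicator D (B *v x \<omega>, \<Phi> (cols \<omega>)) \<partial>M)"
      by (rule nn_integral_cong) (auto simp: \<Phi>_cols indicator_def)
    also have "\<dots> = (\<integral>\<^sup>+w. c w * (\<integral>\<^sup>+u. g u * ?f (B *v X u, H w) \<partial>leb ?J) \<partial>?P)"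
      using joint[of "\<lambda>z. indicator S (fst (snd z)) * indicator D (B *v fst (snd z), \<Phi> (snd (snd z)))"]
      by (simp add: matrix_vector_right_distrib BY pull H_def[symmetric])
    also have "\<dots> = (\<integral>\<^sup>+t. ?f t \<partial>distr M (borel \<Otimes>\<^sub>M borel) (\<lambda>\<omega>. (B *v x \<omega>, Z \<omega>)))"
      by (rule law_T[symmetric]) measurable
    finally show "emeasure M {\<omega> \<in> space M. x \<omega> \<in> S \<and> (B *v x \<omega>, Z \<omega>) \<in> D} =
      (\<integral>\<^sup>+t. ?f t \<partial>distr M (borel \<Otimes>\<^sub>M borel) (\<lambda>\<omega>. (B *v x \<omega>, Z \<omega>)))" .
  qed measurable
  show ?thesis
    using post pred \<kappa>_eq unfolding B_def W_eq by blast
qed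

end
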